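(* Let $(M,h)$ be a Hermitian manifold of complex dimension $n$ with background Riemannian metric $g=\mathrm{Re}\,h$, and let $D$ be the metric connection on $TM$ induced by the Chern connection under the bundle isomorphism $u\mapsto u_o=\frac12(u-\sqrt{-1}Ju)$ from $TM$ to $T^{1,0}M$. Let $\mathfrak R_{ij}$ $(1\le i,j\le 2n)$ be the Ricci curvature tensor of the induced metric connection $D$, and let $b_{\alpha\bar\beta}=\frac{\partial T_\alpha}{\partial\bar z^\beta}-\frac{\partial\overline{T_\beta}}{\partial z^\alpha}$, where $T_\beta$ is the trace of the torsion of the Chern connection. Then $\mathfrak R_{ij}=\mathfrak R_{ji}$ for all $i,j$ if and only if $b_{\alpha\bar\beta}=0$ for all $\alpha,\beta$.
   Context: Greek indices run from $1$ to $n$, Latin indices from $1$ to $2n$. Local holomorphic coordinates are $z^\alpha=x^\alpha+\sqrt{-1}x^{n+\alpha}$; $h=h_{\alpha\bar\beta}\,dz^\alpha d\bar z^\beta$ and $g=\mathrm{Re}\,h=g_{ij}dx^idx^j$, so that $g(u,v)=\mathrm{Re}(h_{\alpha\bar\beta}\xi^\alpha\bar\eta^\beta)$ for $u_o=\xi^\alpha\frac{\partial}{\partial z^\alpha},\ v_o=\eta^\alpha\frac{\partial}{\partial z^\alpha}$. $J$ is the complex structure and $(h^{\bar\beta\alpha})$ denotes the inverse matrix of $(h_{\alpha\bar\beta})$. The Chern connection is the unique connection on $T^{1,0}M$ compatible with $h$ and the holomorphic structure; its connection 1-forms are $\theta^\alpha_\beta=\Gamma^\alpha_{\beta;\gamma}dz^\gamma$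 with $\Gamma^\alpha_{\beta;\gamma}=h^{\bar\lambda\alpha}\frac{\partial h_{\beta\bar\lambda}}{\partial z^\gamma}$. Its torsion tensor is $T^\alpha_{\beta\gamma}=\Gamma^\alpha_{\beta;\gamma}-\Gamma^\alpha_{\gamma;\beta}$, and $T_\beta=\sum_{\alpha=1}^nT^\alpha_{\beta\alpha}$. The induced metric connection, still denoted $D$, is the connection on the real tangent bundle $TM$ obtained by transporting the Chern connection through $u\mapsto u_o$, i.e. $(D_vu)_o=D_v(u_o)$ for real vector fields $u,v$. Its curvature is $(D^2u)(v,w)=D_vD_wu-D_wD_vu-D_{[v,w]}u$. Its Ricci curvature tensor is $$\mathfrak R_{ij}=\sum_{k=1}^{2n}g\Big(\big(D^2\tfrac{\partial}{\partial x^i}\big)\big(e_k,\tfrac{\partial}{\partial x^j}\big),e_k\Big),$$ where $\{e_k\}_{k=1}^{2n}$ is any $g$-orthonormal frame. *)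

theory Defs
  imports "HOL-Analysis.Analysis"
begin

(* The n complex coordinates are indexed by 'n, the 2n real ones by 'n + 'n:
   Inl a stands for the index a, Inr a for n + a, so that z^a = x^a + i x^(n+a). *)

type_synonym 'n pt = "complex ^ 'n"
type_synonym 'n rvec = "real ^ ('n + 'n)"
type_synonym 'n cvec = "complex ^ ('n + 'n)"

(* Meant for open S in finite-dimensional domains. *)
primrec Ck_on :: "nat \<Rightarrow> ('a::real_normed_vector \<Rightarrow> 'b::real_normed_vector) \<Rightarrow> 'a set \<Rightarrow> bool" where
  "Ck_on 0 f S \<longleftrightarrow> continuous_on S f"
| "Ck_on (Suc k) f S \<longleftrightarrow>
     f differentiable_on S \<and> (\<forall>v. Ck_on k (\<lambda>x. frechet_derivative f (at x) v) S)"

definition smooth_on :: "'a::real_normed_vector set \<Rightarrow> ('a \<Rightarrow> 'b::real_normed_vector) \<Rightarrow> bool" where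
  "smooth_on S f \<longleftrightarrow> (\<forall>k. Ck_on k f S)"

definition holomorphic_map_on :: "'n::finite pt set \<Rightarrow> ('n pt \<Rightarrow> 'n pt) \<Rightarrow> bool" where
  "holomorphic_map_on W F \<longleftrightarrow>
     (\<forall>z\<in>W. \<exists>L. (F has_derivative L) (at z) \<and> (\<forall>c v. L (c *s v) = c *s L v))"

definition z_of_x :: "'n::finite rvec \<Rightarrow> 'n pt" where
  "z_of_x x = (\<chi> \<alpha>. Complex (x $ Inl \<alpha>) (x $ Inr \<alpha>))"

definition d_x :: "'n::finite + 'n \<Rightarrow> ('n pt \<Rightarrow> 'b::real_normed_vector) \<Rightarrow> 'n pt \<Rightarrow> 'b" where
  "d_x i f z = frechet_derivative f (at z) (z_of_x (axis i 1))"

definition d_z :: "'n::finite \<Rightarrow> ('n pt \<Rightarrow> complex) \<Rightarrow> 'n pt \<Rightarrow> complex" where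
  "d_z \<alpha> f z = (d_x (Inl \<alpha>) f z - \<i> * d_x (Inr \<alpha>) f z) / 2"

definition d_zbar :: "'n::finite \<Rightarrow> ('n pt \<Rightarrow> complex) \<Rightarrow> 'n pt \<Rightarrow> complex" where
  "d_zbar \<alpha> f z = (d_x (Inl \<alpha>) f z + \<i> * d_x (Inr \<alpha>) f z) / 2"

definition deriv_along ::
  "('n::finite pt \<Rightarrow> 'n rvec) \<Rightarrow> ('n pt \<Rightarrow> 'b::real_normed_vector) \<Rightarrow> 'n pt \<Rightarrow> 'b" where
  "deriv_along v f z = (\<Sum>i\<in>UNIV. (v z $ i) *\<^sub>R d_x i f z)"

definition lie_bracket ::
  "('n::finite pt \<Rightarrow> 'n rvec) \<Rightarrow> ('n pt \<Rightarrow> 'n rvec) \<Rightarrow> 'n pt \<Rightarrow> 'n rvec" where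
  "lie_bracket v w z = deriv_along v w z - deriv_along w v z"

datatype ('a, 'n) chart = Chart (chart_dom: "'a set") (coords: "'a \<Rightarrow> complex ^ 'n")

definition chart_img :: "('a, 'n::finite) chart \<Rightarrow> 'n pt set" where
  "chart_img c = coords c ` chart_dom c"

definition transition :: "('a, 'n::finite) chart \<Rightarrow> ('a, 'n) chart \<Rightarrow> 'n pt \<Rightarrow> 'n pt" where
  "transition c c' z = coords c' (inv_into (chart_dom c) (coords c) z)"

definition is_chart :: "('a::topological_space, 'n::finite) chart \<Rightarrow> bool" where
  "is_chart c \<longleftrightarrow> open (chart_dom c) \<and> open (chart_img c) \<and>
     (\<exists>\<psi>. homeomorphism (chart_dom c) (chart_img c) (coords c) \<psi>)"

definition complex_atlas :: "('a::topological_space, 'n::finite) chart set \<Rightarrow> bool" where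
  "complex_atlas A \<longleftrightarrow>
     (\<forall>c\<in>A. is_chart c) \<and>
     (\<Union>c\<in>A. chart_dom c) = UNIV \<and>
     (\<forall>c\<in>A. \<forall>c'\<in>A.
        holomorphic_map_on (coords c ` (chart_dom c \<inter> chart_dom c')) (transition c c'))"

(* h c z $ \<alpha> $ \<beta> is the component of the metric at the point with coordinates z in the
   chart c, with \<beta> the conjugate-linear index. The last clause is the tensor transformation law. *)
definition hermitian_metric ::
  "('a::topological_space, 'n::finite) chart set \<Rightarrow>
   (('a, 'n) chart \<Rightarrow> 'n pt \<Rightarrow> complex ^ 'n ^ 'n) \<Rightarrow> bool" where
  "hermitian_metric A h \<longleftrightarrow>
     (\<forall>c\<in>A. smooth_on (chart_img c) (h c)) \<and>
     (\<forall>c\<in>A. \<forall>z\<in>chart_img c. \<forall>\<alpha> \<beta>. h c z $ \<alpha> $ \<beta> = cnj (h c z $ \<beta> $ \<alpha>)) \<and>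
     (\<forall>c\<in>A. \<forall>z\<in>chart_img c. \<forall>\<xi>::complex ^ 'n. \<xi> \<noteq> 0 \<longrightarrow>
        Re (\<Sum>\<alpha>\<in>UNIV. \<Sum>\<beta>\<in>UNIV. h c z $ \<alpha> $ \<beta> * \<xi> $ \<alpha> * cnj (\<xi> $ \<beta>)) > 0) \<and>
     (\<forall>c\<in>A. \<forall>c'\<in>A. \<forall>z\<in>coords c ` (chart_dom c \<inter> chart_dom c'). \<forall>\<alpha> \<beta>.
        h c z $ \<alpha> $ \<beta> =
          (\<Sum>\<mu>\<in>UNIV. \<Sum>\<nu>\<in>UNIV. h c' (transition c c' z) $ \<mu> $ \<nu> *
             d_z \<alpha> (\<lambda>y. transition c c' y $ \<mu>) z * cnj (d_z \<beta> (\<lambda>y. transition c c' y $ \<nu>) z)))"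

definition hermitian_manifold ::
  "('a::{t2_space, second_countable_topology}, 'n::finite) chart set \<Rightarrow>
   (('a, 'n) chart \<Rightarrow> 'n pt \<Rightarrow> complex ^ 'n ^ 'n) \<Rightarrow> bool" where
  "hermitian_manifold A h \<longleftrightarrow> complex_atlas A \<and> hermitian_metric A h"

(* Real and complexified tangent vectors are given by their components in the frame
   d/dx^i; this J serves both. *)
definition J :: "'k::ab_group_add ^ ('n::finite + 'n) \<Rightarrow> 'k ^ ('n + 'n)" where
  "J u = (\<chi> i. case i of Inl \<alpha> \<Rightarrow> - (u $ Inr \<alpha>) | Inr \<alpha> \<Rightarrow> u $ Inl \<alpha>)"

definition complexify :: "'n::finite rvec \<Rightarrow> 'n cvec" where
  "complexify u = (\<chi> i. complex_of_real (u $ i))"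

definition T10 :: "'n::finite cvec set" where
  "T10 = {s. J s = \<i> *s s}"

definition to_T10 :: "'n::finite rvec \<Rightarrow> 'n cvec" where
  "to_T10 u = (1 / 2) *s (complexify u - \<i> *s complexify (J u))"

(* dz^\<alpha> applied to s; for s in T10 this is the component of s along d/dz^\<alpha>. *)
definition dz :: "'n::finite \<Rightarrow> 'n cvec \<Rightarrow> complex" where
  "dz \<alpha> s = s $ Inl \<alpha> + \<i> * s $ Inr \<alpha>"

definition herm :: "complex ^ 'n ^ 'n \<Rightarrow> 'n::finite cvec \<Rightarrow> 'n cvec \<Rightarrow> complex" where
  "herm H s t = (\<Sum>\<alpha>\<in>UNIV. \<Sum>\<beta>\<in>UNIV. H $ \<alpha> $ \<beta> * dz \<alpha> s * cnj (dz \<beta> t))"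

definition riem :: "complex ^ 'n ^ 'n \<Rightarrow> 'n::finite rvec \<Rightarrow> 'n rvec \<Rightarrow> real" where
  "riem H u v = Re (herm H (to_T10 u) (to_T10 v))"

definition T10_field :: "'n::finite pt set \<Rightarrow> ('n pt \<Rightarrow> 'n cvec) \<Rightarrow> bool" where
  "T10_field V s \<longleftrightarrow> smooth_on V s \<and> (\<forall>z\<in>V. s z \<in> T10)"

type_synonym 'n conn = "('n pt \<Rightarrow> 'n rvec) \<Rightarrow> ('n pt \<Rightarrow> 'n cvec) \<Rightarrow> 'n pt \<Rightarrow> 'n cvec"

(* Connections on T10 over the open set V. Fields are total functions of which only the
   restriction to V matters: the Leibniz rule and linearity over functions, applied to the
   indicator function of the complement of V, show that D v s on V depends only on v and s on V. *)
definition connection_on :: "'n::finite pt set \<Rightarrow> 'n conn \<Rightarrow> bool" where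
  "connection_on V D \<longleftrightarrow>
     (\<forall>v s. smooth_on V v \<and> T10_field V s \<longrightarrow> T10_field V (D v s)) \<and>
     (\<forall>v w s. smooth_on V v \<and> smooth_on V w \<and> T10_field V s \<longrightarrow>
        (\<forall>z\<in>V. D (\<lambda>y. v y + w y) s z = D v s z + D w s z)) \<and>
     (\<forall>(f :: 'n pt \<Rightarrow> real) v s. smooth_on V f \<and> smooth_on V v \<and> T10_field V s \<longrightarrow>
        (\<forall>z\<in>V. D (\<lambda>y. f y *\<^sub>R v y) s z = f z *\<^sub>R D v s z)) \<and>
     (\<forall>v s t. smooth_on V v \<and> T10_field V s \<and> T10_field V t \<longrightarrow>
        (\<forall>z\<in>V. D v (\<lambda>y. s y + t y) z = D v s z + D v t z)) \<and>
     (\<forall>(f :: 'n pt \<Rightarrow> complex) v s. smooth_on V f \<and> smooth_on V v \<and> T10_field V s \<longrightarrow>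
        (\<forall>z\<in>V. D v (\<lambda>y. f y *s s y) z = deriv_along v f z *s s z + f z *s D v s z))"

definition metric_compatible ::
  "'n::finite pt set \<Rightarrow> ('n pt \<Rightarrow> complex ^ 'n ^ 'n) \<Rightarrow> 'n conn \<Rightarrow> bool" where
  "metric_compatible V h D \<longleftrightarrow>
     (\<forall>v s t. smooth_on V v \<and> T10_field V s \<and> T10_field V t \<longrightarrow>
        (\<forall>z\<in>V. deriv_along v (\<lambda>y. herm (h y) (s y) (t y)) z =
           herm (h z) (D v s z) (t z) + herm (h z) (s z) (D v t z)))"

(* The (0,1)-part of D is the dbar-operator: the vector v + i J v is twice the (0,1)-part of v.
   As the frame d/dz^\<alpha> is holomorphic with constant coefficients in the d/dx^i,
   dbar acts componentwise. *)
definition holomorphic_compatible :: "'n::finite pt set \<Rightarrow> 'n conn \<Rightarrow> bool" where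
  "holomorphic_compatible V D \<longleftrightarrow>
     (\<forall>v s. smooth_on V v \<and> T10_field V s \<longrightarrow>
        (\<forall>z\<in>V. D v s z + \<i> *s D (\<lambda>y. J (v y)) s z =
           deriv_along v s z + \<i> *s deriv_along (\<lambda>y. J (v y)) s z))"

(* Such a D is unique on V, so the Chern connections of two charts agree on the overlap and
   the Chern connection of the manifold is given by its restrictions to the chart domains. *)
definition chern_connection_on ::
  "'n::finite pt set \<Rightarrow> ('n pt \<Rightarrow> complex ^ 'n ^ 'n) \<Rightarrow> 'n conn \<Rightarrow> bool" where
  "chern_connection_on V h D \<longleftrightarrow>
     connection_on V D \<and> metric_compatible V h D \<and> holomorphic_compatible V D"

(* christoffel h \<alpha> \<beta> \<gamma> is the coefficient with upper index \<alpha> and lower indices \<beta>;\<gamma>. *)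
definition christoffel ::
  "('n::finite pt \<Rightarrow> complex ^ 'n ^ 'n) \<Rightarrow> 'n \<Rightarrow> 'n \<Rightarrow> 'n \<Rightarrow> 'n pt \<Rightarrow> complex" where
  "christoffel h \<alpha> \<beta> \<gamma> z =
     (\<Sum>\<mu>\<in>UNIV. matrix_inv (h z) $ \<mu> $ \<alpha> * d_z \<gamma> (\<lambda>y. h y $ \<beta> $ \<mu>) z)"

definition torsion ::
  "('n::finite pt \<Rightarrow> complex ^ 'n ^ 'n) \<Rightarrow> 'n \<Rightarrow> 'n \<Rightarrow> 'n \<Rightarrow> 'n pt \<Rightarrow> complex" where
  "torsion h \<alpha> \<beta> \<gamma> z = christoffel h \<alpha> \<beta> \<gamma> z - christoffel h \<alpha> \<gamma> \<beta> z"

definition torsion_trace ::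
  "('n::finite pt \<Rightarrow> complex ^ 'n ^ 'n) \<Rightarrow> 'n \<Rightarrow> 'n pt \<Rightarrow> complex" where
  "torsion_trace h \<beta> z = (\<Sum>\<alpha>\<in>UNIV. torsion h \<alpha> \<beta> \<alpha> z)"

definition b_form ::
  "('n::finite pt \<Rightarrow> complex ^ 'n ^ 'n) \<Rightarrow> 'n \<Rightarrow> 'n \<Rightarrow> 'n pt \<Rightarrow> complex" where
  "b_form h \<alpha> \<beta> z =
     d_zbar \<beta> (torsion_trace h \<alpha>) z - d_z \<alpha> (\<lambda>y. cnj (torsion_trace h \<beta> y)) z"

definition induced ::
  "'n::finite conn \<Rightarrow> ('n pt \<Rightarrow> 'n rvec) \<Rightarrow> ('n pt \<Rightarrow> 'n rvec) \<Rightarrow> 'n pt \<Rightarrow> 'n rvec" where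
  "induced D v u z = (THE w. to_T10 w = D v (\<lambda>y. to_T10 (u y)) z)"

(* curvature D u v w is (D^2 u)(v, w). *)
definition curvature ::
  "(('n::finite pt \<Rightarrow> 'n rvec) \<Rightarrow> ('n pt \<Rightarrow> 'n rvec) \<Rightarrow> 'n pt \<Rightarrow> 'n rvec) \<Rightarrow>
   ('n pt \<Rightarrow> 'n rvec) \<Rightarrow> ('n pt \<Rightarrow> 'n rvec) \<Rightarrow> ('n pt \<Rightarrow> 'n rvec) \<Rightarrow> 'n pt \<Rightarrow> 'n rvec" where
  "curvature D u v w z = D v (D w u) z - D w (D v u) z - D (lie_bracket v w) u z"

definition orthonormal_frame ::
  "complex ^ 'n ^ 'n \<Rightarrow> ('n::finite + 'n \<Rightarrow> 'n rvec) \<Rightarrow> bool" where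
  "orthonormal_frame H e \<longleftrightarrow> (\<forall>k l. riem H (e k) (e l) = (if k = l then 1 else 0))"

(* The curvature is tensorial, so the vectors e k of a frame of the tangent space at z may be
   extended to vector fields arbitrarily; here, with constant coefficients. The definite
   description expresses that the sum is the same for every orthonormal frame. *)
definition ricci ::
  "('n::finite pt \<Rightarrow> complex ^ 'n ^ 'n) \<Rightarrow> 'n conn \<Rightarrow> 'n + 'n \<Rightarrow> 'n + 'n \<Rightarrow> 'n pt \<Rightarrow> real" where
  "ricci h D i j z = (THE r. \<forall>e. orthonormal_frame (h z) e \<longrightarrow>
     r = (\<Sum>k\<in>UNIV. riem (h z)
            (curvature (induced D) (\<lambda>_. axis i 1) (\<lambda>_. e k) (\<lambda>_. axis j 1) z) (e k)))"

end

theory Submission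
  imports Defs
begin

text \<open>
  Everything is local and pointwise. Compatibility with the metric and with the holomorphic structure
  forces the connection form of the Chern connection to be \<open>\<Gamma>\<close>, and \<open>H \<Gamma> = \<partial>H\<close> together with the
  symmetry of second derivatives shows that its curvature is of type (1,1), with components
  \<open>- \<partial>\<Gamma> / \<partial>zbar\<close>. The sum over an orthonormal frame is the trace of a real-linear map of tangent
  vectors; only the complex-linear part of that map contributes, so that the Ricci tensor is
  \<open>- 2 Re (S(\<beta>,\<delta>) u(\<beta>) cnj (w(\<delta>)))\<close>, where \<open>S(\<beta>,\<delta>)\<close> is the \<open>zbar(\<delta>)\<close>-derivative of
  \<open>\<Sum>\<sigma>. \<Gamma>(\<sigma>; \<beta>, \<sigma>)\<close>. It is symmetric iff \<open>S\<close> is Hermitian. The torsion trace differs from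
  \<open>\<Sum>\<sigma>. \<Gamma>(\<sigma>; \<beta>, \<sigma>)\<close> by \<open>\<partial> log det H\<close>, whose \<open>zbar\<close>-derivative is Hermitian; hence \<open>b\<close> is
  \<open>S\<close> minus its adjoint.
\<close>

section \<open>Smooth functions and symmetry of second derivatives\<close>

text \<open>Derivative formulas hold only at points of \<open>S\<close>, while \<open>Ck_on\<close>
  speaks of total functions. Openness makes derivatives at points of \<open>S\<close> depend only on
  values in \<open>S\<close>, so such formulas may be substituted at every order.\<close>

lemma Ck_on_cong:
  assumes "open S" "\<And>x. x \<in> S \<Longrightarrow> f x = g x"
  shows "Ck_on k f S \<longleftrightarrow> Ck_on k g S"
proof -
  have *: "Ck_on k g S" if "Ck_on k f S" "\<And>x. x \<in> S \<Longrightarrow> f x = g x" for k f g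
    using that
  proof (induction k arbitrary: f g)
    case 0
    then show ?case by (auto cong: continuous_on_cong)
  next
    case (Suc k)
    have diff: "f differentiable at x" if "x \<in> S" for x
      using Suc.prems(1) that assms(1) unfolding Ck_on.simps differentiable_on_def
      by (metis at_within_open)
    have fd: "frechet_derivative f (at x) = frechet_derivative g (at x)" if "x \<in> S" for x
      by (rule frechet_derivative_transform_within_open[OF diff[OF that] assms(1) that Suc.prems(2)])
    have "g differentiable_on S"
      unfolding differentiable_on_def
    proof
      fix x assume x: "x \<in> S"
      then have "f differentiable at x within S"
        using Suc.prems(1) by (simp add: differentiable_on_def)
      then show "g differentiable at x within S"
        by (rule differentiable_transform_within[OF _ zero_less_one x]) (use Suc.prems(2) in auto)
    qed
    moreover have "Ck_on k (\<lambda>x. frechet_derivative g (at x) v) S" for v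
      by (rule Suc.IH[of "\<lambda>x. frechet_derivative f (at x) v"]) (use Suc.prems fd in auto)
    ultimately show ?case by simp
  qed
  show ?thesis using *[of k f g] *[of k g f] assms(2) by auto
qed

lemma smooth_on_cong:
  assumes "open S" "\<And>x. x \<in> S \<Longrightarrow> f x = g x"
  shows "smooth_on S f \<longleftrightarrow> smooth_on S g"
  using Ck_on_cong[OF assms] by (auto simp: smooth_on_def)

lemma smooth_on_frechet_derivative:
  "smooth_on S f \<Longrightarrow> smooth_on S (\<lambda>x. frechet_derivative f (at x) v)"
  unfolding smooth_on_def
proof
  fix k
  assume "\<forall>k. Ck_on k f S"
  then have "Ck_on (Suc k) f S" ..
  then show "Ck_on k (\<lambda>x. frechet_derivative f (at x) v) S" by simp
qed

lemma smooth_on_differentiable: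
  assumes "smooth_on S f" "open S" "x \<in> S"
  shows "f differentiable at x"
proof -
  have "Ck_on (Suc 0) f S" using assms(1) unfolding smooth_on_def ..
  then have "f differentiable at x within S" using assms(3) by (simp add: differentiable_on_def)
  then show ?thesis by (simp only: at_within_open[OF assms(3,2)])
qed

lemma smooth_on_continuous_on: "smooth_on S f \<Longrightarrow> continuous_on S f"
  unfolding smooth_on_def by (metis Ck_on.simps(1))

lemma Ck_on_const: "Ck_on k (\<lambda>x. c) S"
  by (induction k arbitrary: c) auto

lemma smooth_on_const: "smooth_on S (\<lambda>x. c)"
  by (simp add: smooth_on_def Ck_on_const)

lemma frechet_derivative_bounded_linear:
  assumes "bounded_linear L" "f differentiable at x"
  shows "frechet_derivative (\<lambda>y. L (f y)) (at x) v = L (frechet_derivative f (at x) v)"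
  using frechet_derivative_at[OF bounded_linear.has_derivative[OF assms(1)
      iffD1[OF frechet_derivative_works assms(2)]]]
  by (simp add: fun_eq_iff)

text \<open>The induction generalizes over \<open>f\<close>, because a directional derivative of
  \<open>L\<close> after \<open>f\<close> is again \<open>L\<close> after a smooth function.\<close>

lemma smooth_on_bounded_linear:
  assumes "bounded_linear L" "open S" "smooth_on S f"
  shows "smooth_on S (\<lambda>x. L (f x))"
proof -
  have "Ck_on k (\<lambda>x. L (f x)) S" if "smooth_on S f" for k
    using that
  proof (induction k arbitrary: f)
    case 0
    then show ?case
      using bounded_linear.continuous_on[OF assms(1)] by (auto dest: smooth_on_continuous_on)
  next
    case (Suc k)
    note d = smooth_on_differentiable[OF Suc.prems assms(2)]
    have "(\<lambda>x. L (f x)) differentiable_on S"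
      by (intro differentiable_at_imp_differentiable_on differentiableI)
        (rule bounded_linear.has_derivative[OF assms(1) iffD1[OF frechet_derivative_works d]])
    moreover have "Ck_on k (\<lambda>x. frechet_derivative (\<lambda>y. L (f y)) (at x) v) S" for v
      by (rule iffD1[OF Ck_on_cong[OF assms(2)]
            Suc.IH[OF smooth_on_frechet_derivative[OF Suc.prems, of v]]])
        (simp add: frechet_derivative_bounded_linear[OF assms(1) d])
    ultimately show ?case by simp
  qed
  then show ?thesis using assms(3) by (simp add: smooth_on_def)
qed

lemma frechet_derivative_add:
  assumes "f differentiable at x" "g differentiable at x"
  shows "frechet_derivative (\<lambda>y. f y + g y) (at x) v =
    frechet_derivative f (at x) v + frechet_derivative g (at x) v"
  using frechet_derivative_at[OF has_derivative_add[OF assms[THEN iffD1[OF frechet_derivative_works]]]]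
  by (simp add: fun_eq_iff)

lemma smooth_on_add:
  assumes "open S" "smooth_on S f" "smooth_on S g"
  shows "smooth_on S (\<lambda>x. f x + g x)"
proof -
  have "Ck_on k (\<lambda>x. f x + g x) S" if "smooth_on S f" "smooth_on S g" for k
    using that
  proof (induction k arbitrary: f g)
    case 0
    then show ?case by (simp add: smooth_on_continuous_on continuous_on_add)
  next
    case (Suc k)
    note d = Suc.prems[THEN smooth_on_differentiable, OF assms(1)]
    have "(\<lambda>x. f x + g x) differentiable_on S"
      by (intro differentiable_at_imp_differentiable_on differentiable_add d)
    moreover have "Ck_on k (\<lambda>x. frechet_derivative (\<lambda>y. f y + g y) (at x) v) S" for v
      by (rule iffD1[OF Ck_on_cong[OF assms(1)]
            Suc.IH[OF smooth_on_frechet_derivative[OF Suc.prems(1), of v]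
              smooth_on_frechet_derivative[OF Suc.prems(2), of v]]])
        (simp add: frechet_derivative_add d)
    ultimately show ?case by simp
  qed
  then show ?thesis using assms by (simp add: smooth_on_def)
qed

lemma smooth_on_sum:
  assumes "open S" "\<And>i. i \<in> I \<Longrightarrow> smooth_on S (f i)"
  shows "smooth_on S (\<lambda>x. \<Sum>i\<in>I. f i x)"
  using assms(2)
  by (induction I rule: infinite_finite_induct) (simp_all add: smooth_on_const smooth_on_add[OF assms(1)])

section \<open>Symmetry of second derivatives\<close>

lemma has_real_derivative_along_line:
  fixes f :: "'a::real_normed_vector \<Rightarrow> real"
  assumes "f differentiable at (x + t *\<^sub>R v)"
  shows "((\<lambda>s. f (x + s *\<^sub>R v)) has_real_derivative frechet_derivative f (at (x + t *\<^sub>R v)) v) (at t)"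
proof -
  let ?F = "frechet_derivative f (at (x + t *\<^sub>R v))"
  have "((\<lambda>s. f (x + s *\<^sub>R v)) has_derivative (\<lambda>s. ?F (s *\<^sub>R v))) (at t)"
  proof -
    have "((\<lambda>s. x + s *\<^sub>R v) has_derivative (\<lambda>s. s *\<^sub>R v)) (at t)"
      by (auto intro!: derivative_eq_intros)
    from has_derivative_compose[OF this iffD1[OF frechet_derivative_works assms]]
    show ?thesis by simp
  qed
  moreover have "?F (s *\<^sub>R v) = ?F v * s" for s
    using linear_frechet_derivative[OF assms] by (simp add: linear_cmul mult.commute)
  ultimately show ?thesis
    by (simp add: has_field_derivative_def)
qed

text \<open>Two applications of the mean value theorem to the second difference of \<open>f\<close>.\<close>

lemma second_difference_mvt:
  fixes f :: "'a::real_normed_vector \<Rightarrow> real"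
  assumes S: "open S" "smooth_on S f" "ball x r \<subseteq> S" and t: "0 < t" "t * (norm v + norm w) < r"
  obtains p where "dist x p \<le> t * (norm v + norm w)"
    and "f (x + t *\<^sub>R v + t *\<^sub>R w) - f (x + t *\<^sub>R v) - f (x + t *\<^sub>R w) + f x =
      t * t * frechet_derivative (\<lambda>y. frechet_derivative f (at y) v) (at p) w"
proof -
  let ?fv = "\<lambda>y. frechet_derivative f (at y) v"
  have near: "dist x (x + a *\<^sub>R v + b *\<^sub>R w) \<le> t * (norm v + norm w)"
    if "0 \<le> a" "a \<le> t" "0 \<le> b" "b \<le> t" for a b
  proof -
    have "dist x (x + a *\<^sub>R v + b *\<^sub>R w) = norm (a *\<^sub>R v + b *\<^sub>R w)"
      by (metis add.assoc add.right_neutral dist_add_cancel dist_0_norm)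
    also have "\<dots> \<le> a * norm v + b * norm w"
      using norm_triangle_ineq[of "a *\<^sub>R v" "b *\<^sub>R w"] that by simp
    also have "\<dots> \<le> t * norm v + t * norm w"
      using that by (intro add_mono mult_right_mono) auto
    finally show ?thesis by (simp add: algebra_simps)
  qed
  have mem: "x + a *\<^sub>R v + b *\<^sub>R w \<in> S"
    if "0 \<le> a" "a \<le> t" "0 \<le> b" "b \<le> t" for a b
    by (rule subsetD[OF S(3)]) (simp only: mem_ball le_less_trans[OF near[OF that] t(2)])
  note df = smooth_on_differentiable[OF S(2,1)]
  note dfv = smooth_on_differentiable[OF smooth_on_frechet_derivative[OF S(2), of v] S(1)]
  \<comment> \<open>First mean value theorem: the second difference is an increment, in direction
    \<open>v\<close>, of the difference between \<open>f\<close> shifted by \<open>t\<close> times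
    \<open>w\<close> and \<open>f\<close> itself.\<close>
  have "((\<lambda>s. f (x + t *\<^sub>R w + s *\<^sub>R v) - f (x + s *\<^sub>R v)) has_real_derivative
      ?fv (x + t *\<^sub>R w + s *\<^sub>R v) - ?fv (x + s *\<^sub>R v)) (at s)" if "0 \<le> s" "s \<le> t" for s
    by (intro DERIV_diff has_real_derivative_along_line df)
      (use mem[of s t] mem[of s 0] that t in \<open>simp_all add: ac_simps\<close>)
  from MVT2[OF t(1) this] obtain a where a: "0 < a" "a < t"
    "f (x + t *\<^sub>R w + t *\<^sub>R v) - f (x + t *\<^sub>R v) - (f (x + t *\<^sub>R w) - f x) =
       t * (?fv (x + t *\<^sub>R w + a *\<^sub>R v) - ?fv (x + a *\<^sub>R v))" by auto
  \<comment> \<open>Second mean value theorem: the resulting difference of \<open>?fv\<close> is an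
    increment in direction \<open>w\<close>, based at the intermediate point just found.\<close>
  have "((\<lambda>s. ?fv (x + a *\<^sub>R v + s *\<^sub>R w)) has_real_derivative
      frechet_derivative ?fv (at (x + a *\<^sub>R v + s *\<^sub>R w)) w) (at s)" if "0 \<le> s" "s \<le> t" for s
    by (intro has_real_derivative_along_line dfv mem) (use that a in auto)
  from MVT2[OF t(1) this] obtain b where b: "0 < b" "b < t"
    "?fv (x + a *\<^sub>R v + t *\<^sub>R w) - ?fv (x + a *\<^sub>R v) =
       t * frechet_derivative ?fv (at (x + a *\<^sub>R v + b *\<^sub>R w)) w" by auto
  show ?thesis
  proof (rule that[OF near[of a b]])
    show "f (x + t *\<^sub>R v + t *\<^sub>R w) - f (x + t *\<^sub>R v) - f (x + t *\<^sub>R w) + f x =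
      t * t * frechet_derivative ?fv (at (x + a *\<^sub>R v + b *\<^sub>R w)) w"
      using a(3) b(3) by (simp add: ac_simps)
  qed (use a b in simp_all)
qed

text \<open>The second difference is symmetric in \<open>v\<close> and \<open>w\<close>. It
  therefore equates one mixed derivative at a point \<open>p\<close> with the other at a point
  \<open>q\<close>, both as close to \<open>x\<close> as desired, and continuity of the two
  transfers the equality to \<open>x\<close>.\<close>

lemma frechet_derivative_symmetric_real:
  fixes f :: "'a::real_normed_vector \<Rightarrow> real"
  assumes S: "open S" "smooth_on S f" "x \<in> S"
  shows "frechet_derivative (\<lambda>y. frechet_derivative f (at y) v) (at x) w =
    frechet_derivative (\<lambda>y. frechet_derivative f (at y) w) (at x) v"
proof (rule ccontr)
  let ?A = "\<lambda>v w x. frechet_derivative (\<lambda>y. frechet_derivative f (at y) v) (at x) w"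
  assume ne: "\<not> ?thesis"
  \<comment> \<open>Half the supposed gap: two equal numbers, each within \<open>e\<close> of one of
    the two mixed derivatives at \<open>x\<close>, would make the gap smaller than itself.\<close>
  define e where "e = \<bar>?A v w x - ?A w v x\<bar> / 2"
  have e: "e > 0" using ne by (simp add: e_def)
  have cont: "isCont (?A a b) x" for a b
    using smooth_on_continuous_on[OF smooth_on_frechet_derivative[OF smooth_on_frechet_derivative[OF S(2)]]] S
    by (simp add: continuous_on_eq_continuous_at)
  from S obtain r where r: "r > 0" "ball x r \<subseteq> S" by (meson open_contains_ball)
  obtain d1 where d1: "d1 > 0" "\<And>y. dist y x < d1 \<Longrightarrow> dist (?A v w y) (?A v w x) < e"
    using cont[of v w] e by (fastforce simp: continuous_at_eps_delta)
  obtain d2 where d2: "d2 > 0" "\<And>y. dist y x < d2 \<Longrightarrow> dist (?A w v y) (?A w v x) < e"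
    using cont[of w v] e by (fastforce simp: continuous_at_eps_delta)
  define d where "d = min r (min d1 d2)"
  have d: "d > 0" "d \<le> r" "d \<le> d1" "d \<le> d2" using r d1 d2 by (auto simp: d_def)
  \<comment> \<open>The summand 1 keeps the denominator positive when \<open>v\<close> and
    \<open>w\<close> both vanish and makes the bound \<open>td\<close> strict.\<close>
  define t where "t = d / (norm v + norm w + 1)"
  have n: "norm v + norm w + 1 > 0" by (simp add: add_nonneg_pos)
  have t: "t > 0" using d n by (simp add: t_def)
  have "t * (norm v + norm w) < t * (norm v + norm w + 1)" using t by simp
  also have "\<dots> = d" using n by (simp add: t_def)
  finally have td: "t * (norm v + norm w) < d" .
  obtain p where p: "dist x p \<le> t * (norm v + norm w)"
    "f (x + t *\<^sub>R v + t *\<^sub>R w) - f (x + t *\<^sub>R v) - f (x + t *\<^sub>R w) + f x = t * t * ?A v w p"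
    using second_difference_mvt[OF S(1,2) r(2) t, of v w] td d by auto
  obtain q where q: "dist x q \<le> t * (norm w + norm v)"
    "f (x + t *\<^sub>R w + t *\<^sub>R v) - f (x + t *\<^sub>R w) - f (x + t *\<^sub>R v) + f x = t * t * ?A w v q"
    using second_difference_mvt[OF S(1,2) r(2) t, of w v] td d by (auto simp: add.commute)
  have "t * t * ?A v w p = t * t * ?A w v q"
    using p(2) q(2) by (simp add: algebra_simps)
  then have eq: "?A v w p = ?A w v q" using t by simp
  have "dist (?A v w p) (?A v w x) < e" "dist (?A w v q) (?A w v x) < e"
    using d1(2)[of p] d2(2)[of q] p(1) q(1) td d by (auto simp: dist_commute add.commute)
  then show False using eq e_def unfolding dist_real_def by (simp add: abs_if split: if_splits)
qed

text \<open>Pairing with a basis vector is bounded linear, hence commutes with both derivatives and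
  reduces the claim to real-valued functions.\<close>

lemma frechet_derivative_symmetric:
  fixes f :: "'a::real_normed_vector \<Rightarrow> 'b::euclidean_space"
  assumes S: "open S" "smooth_on S f" "x \<in> S"
  shows "frechet_derivative (\<lambda>y. frechet_derivative f (at y) v) (at x) w =
    frechet_derivative (\<lambda>y. frechet_derivative f (at y) w) (at x) v"
proof (rule euclidean_eqI)
  fix b :: 'b
  let ?L = "\<lambda>u. u \<bullet> b"
  have L: "bounded_linear ?L" by (rule bounded_linear_inner_left)
  have *: "frechet_derivative (\<lambda>y. frechet_derivative (\<lambda>z. ?L (f z)) (at y) v) (at x) w =
      ?L (frechet_derivative (\<lambda>y. frechet_derivative f (at y) v) (at x) w)" for v w
  proof -
    note s = smooth_on_frechet_derivative[OF S(2), of v]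
    have "frechet_derivative (\<lambda>y. ?L (frechet_derivative f (at y) v)) (at x) =
      frechet_derivative (\<lambda>y. frechet_derivative (\<lambda>z. ?L (f z)) (at y) v) (at x)"
    proof (rule frechet_derivative_transform_within_open[OF _ S(1,3)])
      show "(\<lambda>y. ?L (frechet_derivative f (at y) v)) differentiable at x"
        by (rule smooth_on_differentiable[OF smooth_on_bounded_linear[OF L S(1) s] S(1,3)])
      show "?L (frechet_derivative f (at y) v) = frechet_derivative (\<lambda>z. ?L (f z)) (at y) v"
        if "y \<in> S" for y
        using frechet_derivative_bounded_linear[OF L smooth_on_differentiable[OF S(2,1) that]] by simp
    qed
    then show ?thesis
      using frechet_derivative_bounded_linear[OF L smooth_on_differentiable[OF s S(1,3)], of w]
      by simp
  qed
  show "?L (frechet_derivative (\<lambda>y. frechet_derivative f (at y) v) (at x) w) =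
    ?L (frechet_derivative (\<lambda>y. frechet_derivative f (at y) w) (at x) v)"
    using frechet_derivative_symmetric_real[OF S(1) smooth_on_bounded_linear[OF L S(1,2)] S(3), of v w]
    by (simp add: *)
qed

section \<open>Traces in orthonormal frames\<close>

text \<open>The form is a parameter because the metric varies with the point; the instance used
  below is \<open>riem (H z)\<close>.\<close>

locale pos_def_form =
  fixes g :: "real ^ 'k::finite \<Rightarrow> real ^ 'k \<Rightarrow> real"
  assumes lin: "linear (\<lambda>u. g u v)"
    and sym: "g u v = g v u"
    and pos: "u \<noteq> 0 \<Longrightarrow> g u u > 0"
begin

lemma lin_right: "linear (g u)"
proof -
  have "g u = (\<lambda>v. g v u)" using sym by auto
  then show ?thesis using lin by simp
qed

definition orthonormal_on :: "'k set \<Rightarrow> ('k \<Rightarrow> real ^ 'k) \<Rightarrow> bool" where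
  "orthonormal_on I e \<longleftrightarrow> (\<forall>k\<in>I. \<forall>l\<in>I. g (e k) (e l) = (if k = l then 1 else 0))"

lemma form_sum_left: "finite I \<Longrightarrow> g (\<Sum>k\<in>I. c k *\<^sub>R e k) v = (\<Sum>k\<in>I. c k * g (e k) v)"
  using linear_sum[OF lin, of "\<lambda>k. c k *\<^sub>R e k" I v] linear_cmul[OF lin] by simp

lemma orthonormal_on_form_sum:
  assumes "orthonormal_on I e" "l \<in> I"
  shows "g (\<Sum>k\<in>I. c k *\<^sub>R e k) (e l) = c l"
proof -
  have "g (\<Sum>k\<in>I. c k *\<^sub>R e k) (e l) = (\<Sum>k\<in>I. if k = l then c k else 0)"
    using assms unfolding form_sum_left[OF finite] orthonormal_on_def by (intro sum.cong) auto
  then show ?thesis using assms(2) by simp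
qed

text \<open>Gram-Schmidt, by induction on the index set.\<close>

lemma ex_orthonormal_on: "\<exists>e. orthonormal_on I e"
  using finite[of I]
proof (induction I rule: finite_induct)
  case empty
  then show ?case by (auto simp: orthonormal_on_def)
next
  case (insert j I)
  then obtain e where e: "orthonormal_on I e" by blast
  \<comment> \<open>The index \<open>j\<close> is still free, so the vectors chosen so far cannot
    span the space.\<close>
  have "card (e ` I) < CARD('k)"
  proof -
    have "card (e ` I) \<le> card I" by (simp add: card_image_le)
    also have "\<dots> < card (insert j I)" using insert by simp
    also have "\<dots> \<le> CARD('k)" by (simp add: card_mono)
    finally show ?thesis .
  qed
  then have "dim (e ` I) < DIM(real ^ 'k)"
    using dim_le_card'[of "e ` I"] by simp
  then have "span (e ` I) \<noteq> UNIV"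
    using dim_span[of "e ` I"] by (metis dim_UNIV less_irrefl)
  then obtain v where v: "v \<notin> span (e ` I)" by auto
  \<comment> \<open>The component of \<open>v\<close> orthogonal to the vectors chosen so far; it is
    nonzero because \<open>v\<close> lies outside their span.\<close>
  define u where "u = v - (\<Sum>k\<in>I. g v (e k) *\<^sub>R e k)"
  have "(\<Sum>k\<in>I. g v (e k) *\<^sub>R e k) \<in> span (e ` I)"
    by (intro span_sum span_scale span_base) auto
  then have "u \<noteq> 0" using v by (auto simp: u_def)
  then have p: "g u u > 0" by (rule pos)
  have orth: "g u (e l) = 0" if "l \<in> I" for l
    using linear_diff[OF lin] orthonormal_on_form_sum[OF e that] by (simp add: u_def)
  define u' where "u' = (1 / sqrt (g u u)) *\<^sub>R u"
  have "g u' (e l) = 0" if "l \<in> I" for l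
    using orth[OF that] by (simp add: u'_def linear_cmul[OF lin])
  moreover have "g u' u' = 1"
    using p by (simp add: u'_def linear_cmul[OF lin] linear_cmul[OF lin_right])
  ultimately have "orthonormal_on (insert j I) (e(j := u'))"
    using e insert.hyps sym by (auto simp: orthonormal_on_def)
  then show ?case by blast
qed

text \<open>Pairing with the frame shows independence; as many independent vectors as the dimension
  span, and pairing once more identifies the coefficients.\<close>

lemma orthonormal_expansion:
  assumes e: "orthonormal_on UNIV e"
  shows "v = (\<Sum>k\<in>UNIV. g v (e k) *\<^sub>R e k)"
proof -
  have coeff: "c = (\<lambda>k. 0)" if "(\<Sum>k\<in>UNIV. c k *\<^sub>R e k) = 0" for c
    using orthonormal_on_form_sum[OF e, of _ c] that linear_0[OF lin] by auto
  have inj: "inj e"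
    using e unfolding inj_def orthonormal_on_def by (metis UNIV_I zero_neq_one)
  have "independent (range e)"
    unfolding independent_explicit
  proof (intro conjI allI impI ballI)
    show "finite (range e)" by simp
    fix c x assume c: "(\<Sum>v\<in>range e. c v *\<^sub>R v) = 0" and x: "x \<in> range e"
    have "(\<Sum>k\<in>UNIV. c (e k) *\<^sub>R e k) = 0"
      using c by (simp add: sum.reindex[OF inj])
    from coeff[OF this] x show "c x = 0" by (metis rangeE)
  qed
  then have "UNIV \<subseteq> span (range e)"
    by (intro card_ge_dim_independent) (auto simp: card_image[OF inj])
  then have "v \<in> span (range e)" by blast
  then obtain c where "v = (\<Sum>x\<in>range e. c x *\<^sub>R x)"
    unfolding span_finite[OF finite_imageI[OF finite]] by auto
  then have v: "v = (\<Sum>k\<in>UNIV. c (e k) *\<^sub>R e k)"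
    by (simp add: sum.reindex[OF inj])
  have "g v (e k) = c (e k)" for k
    using orthonormal_on_form_sum[OF e, of k "\<lambda>k. c (e k)"] v by simp
  then show ?thesis using v by simp
qed

text \<open>The right-hand side does not mention the frame: this gives the independence of the frame
  on which the definition of \<open>ricci\<close> relies, and permits computing in the coordinate
  basis. Each image of a basis vector is expanded in \<open>e\<close>, and the basis vectors are
  then reassembled into \<open>e k\<close>.\<close>

lemma orthonormal_trace:
  assumes e: "orthonormal_on UNIV e" and M: "linear M"
  shows "(\<Sum>k\<in>UNIV. g (M (e k)) (e k)) = (\<Sum>i\<in>UNIV. M (axis i 1) $ i)"
proof -
  have "(\<Sum>i\<in>UNIV. M (axis i 1) $ i) = (\<Sum>i\<in>UNIV. (\<Sum>k\<in>UNIV. g (M (axis i 1)) (e k) *\<^sub>R e k) $ i)"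
    using orthonormal_expansion[OF e] by metis
  also have "\<dots> = (\<Sum>k\<in>UNIV. \<Sum>i\<in>UNIV. e k $ i * g (M (axis i 1)) (e k))"
    by (subst sum.swap) (simp add: mult.commute)
  also have "\<dots> = (\<Sum>k\<in>UNIV. g (M (e k)) (e k))"
  proof (intro sum.cong refl)
    fix k
    have "M (e k) = M (\<Sum>i\<in>UNIV. e k $ i *\<^sub>R axis i 1)"
      using basis_expansion[of "e k"] by (simp add: scalar_mult_eq_scaleR)
    also have "\<dots> = (\<Sum>i\<in>UNIV. e k $ i *\<^sub>R M (axis i 1))"
      using M by (simp add: linear_sum linear_cmul)
    finally show "(\<Sum>i\<in>UNIV. e k $ i * g (M (axis i 1)) (e k)) = g (M (e k)) (e k)"
      by (simp add: form_sum_left)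
  qed
  finally show ?thesis by simp
qed

end

section \<open>Wirtinger derivatives and the holomorphic tangent bundle\<close>

lemma sum_UNIV_Plus:
  "(\<Sum>i\<in>UNIV. f (i :: 'a::finite + 'b::finite)) = (\<Sum>a\<in>UNIV. f (Inl a)) + (\<Sum>b\<in>UNIV. f (Inr b))"
  by (simp add: UNIV_Plus_UNIV[symmetric] sum.Plus del: UNIV_Plus_UNIV)

lemma d_x_cong:
  assumes "f differentiable at z" "open V" "z \<in> V" "\<And>y. y \<in> V \<Longrightarrow> f y = g y"
  shows "d_x i f z = d_x i g z"
  unfolding d_x_def by (simp only: frechet_derivative_transform_within_open[OF assms])

lemma d_x_const: "d_x i (\<lambda>y. c) z = 0"
  by (simp add: d_x_def)

lemma d_x_add:
  assumes "f differentiable at z" "g differentiable at z"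
  shows "d_x i (\<lambda>y. f y + g y) z = d_x i f z + d_x i g z"
  unfolding d_x_def by (rule frechet_derivative_add[OF assms])

lemma d_x_bounded_linear:
  assumes "bounded_linear L" "f differentiable at z"
  shows "d_x i (\<lambda>y. L (f y)) z = L (d_x i f z)"
  unfolding d_x_def by (rule frechet_derivative_bounded_linear[OF assms])

lemma d_x_mult:
  fixes f g :: "'n::finite pt \<Rightarrow> complex"
  assumes "f differentiable at z" "g differentiable at z"
  shows "d_x i (\<lambda>y. f y * g y) z = d_x i f z * g z + f z * d_x i g z"
  using frechet_derivative_at[OF has_derivative_mult[OF assms[THEN iffD1[OF frechet_derivative_works]]], symmetric]
  unfolding d_x_def by simp

lemma smooth_on_d_x: "smooth_on V f \<Longrightarrow> smooth_on V (d_x i f)"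
  unfolding d_x_def by (rule smooth_on_frechet_derivative)

lemma d_x_commute:
  fixes f :: "'n::finite pt \<Rightarrow> 'b::euclidean_space"
  assumes "open V" "smooth_on V f" "z \<in> V"
  shows "d_x i (d_x j f) z = d_x j (d_x i f) z"
  unfolding d_x_def by (rule frechet_derivative_symmetric[OF assms])

text \<open>A common form of the two Wirtinger derivatives: \<open>\<kappa> = - \<i>\<close> gives
  \<open>d_z\<close> and \<open>\<kappa> = \<i>\<close> gives \<open>d_zbar\<close>, so each rule is
  proved once.\<close>

definition wirtinger :: "complex \<Rightarrow> 'n::finite \<Rightarrow> ('n pt \<Rightarrow> complex) \<Rightarrow> 'n pt \<Rightarrow> complex" where
  "wirtinger \<kappa> \<alpha> f z = (d_x (Inl \<alpha>) f z + \<kappa> * d_x (Inr \<alpha>) f z) / 2"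

lemma d_z_wirtinger: "d_z = wirtinger (- \<i>)"
  by (simp add: fun_eq_iff d_z_def wirtinger_def)

lemma d_zbar_wirtinger: "d_zbar = wirtinger \<i>"
  by (simp add: fun_eq_iff d_zbar_def wirtinger_def)

lemma wirtinger_cong:
  assumes "f differentiable at z" "open V" "z \<in> V" "\<And>y. y \<in> V \<Longrightarrow> f y = g y"
  shows "wirtinger \<kappa> \<alpha> f z = wirtinger \<kappa> \<alpha> g z"
  unfolding wirtinger_def by (simp only: d_x_cong[OF assms])

lemma wirtinger_add:
  assumes "f differentiable at z" "g differentiable at z"
  shows "wirtinger \<kappa> \<alpha> (\<lambda>y. f y + g y) z = wirtinger \<kappa> \<alpha> f z + wirtinger \<kappa> \<alpha> g z"
  unfolding wirtinger_def by (simp add: d_x_add[OF assms] field_simps)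

lemma wirtinger_diff:
  assumes "f differentiable at z" "g differentiable at z"
  shows "wirtinger \<kappa> \<alpha> (\<lambda>y. f y - g y) z = wirtinger \<kappa> \<alpha> f z - wirtinger \<kappa> \<alpha> g z"
proof -
  have "wirtinger \<kappa> \<alpha> (\<lambda>y. f y - g y + g y) z =
      wirtinger \<kappa> \<alpha> (\<lambda>y. f y - g y) z + wirtinger \<kappa> \<alpha> g z"
    by (intro wirtinger_add differentiable_diff assms)
  then show ?thesis by simp
qed

lemma wirtinger_const: "wirtinger \<kappa> \<alpha> (\<lambda>y. c) z = 0"
  by (simp add: wirtinger_def d_x_const)

lemma wirtinger_sum:
  assumes "finite I" "\<And>k. k \<in> I \<Longrightarrow> f k differentiable at z"
  shows "wirtinger \<kappa> \<alpha> (\<lambda>y. \<Sum>k\<in>I. f k y) z = (\<Sum>k\<in>I. wirtinger \<kappa> \<alpha> (f k) z)"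
  using assms by (induction I) (simp_all add: wirtinger_const wirtinger_add differentiable_sum)

lemma wirtinger_mult:
  assumes "f differentiable at z" "g differentiable at z"
  shows "wirtinger \<kappa> \<alpha> (\<lambda>y. f y * g y) z = wirtinger \<kappa> \<alpha> f z * g z + f z * wirtinger \<kappa> \<alpha> g z"
  unfolding wirtinger_def by (simp add: d_x_mult[OF assms] field_simps)

lemma wirtinger_cnj:
  assumes "f differentiable at z"
  shows "wirtinger \<kappa> \<alpha> (\<lambda>y. cnj (f y)) z = cnj (wirtinger (cnj \<kappa>) \<alpha> f z)"
  unfolding wirtinger_def by (simp add: d_x_bounded_linear[OF bounded_linear_cnj assms])

lemma smooth_on_wirtinger:
  assumes "open V" "smooth_on V f"
  shows "smooth_on V (wirtinger \<kappa> \<alpha> f)"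
proof -
  have "smooth_on V (\<lambda>z. (1 / 2) * d_x (Inl \<alpha>) f z + (\<kappa> / 2) * d_x (Inr \<alpha>) f z)"
    by (intro smooth_on_add smooth_on_bounded_linear[OF bounded_linear_mult_right] smooth_on_d_x assms)
  then show ?thesis
    by (rule iffD1[OF smooth_on_cong[OF assms(1)], rotated]) (simp add: wirtinger_def field_simps)
qed

text \<open>Both operators are combinations of real partial derivatives with constant coefficients,
  and the latter commute on smooth functions.\<close>

lemma wirtinger_commute:
  assumes "open V" "smooth_on V f" "z \<in> V"
  shows "wirtinger \<kappa> \<alpha> (wirtinger \<kappa>' \<beta> f) z = wirtinger \<kappa>' \<beta> (wirtinger \<kappa> \<alpha> f) z"
proof -
  have *: "d_x i (wirtinger \<kappa> \<alpha> f) z =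
      (d_x i (d_x (Inl \<alpha>) f) z + \<kappa> * d_x i (d_x (Inr \<alpha>) f) z) / 2" for i \<kappa> \<alpha>
  proof -
    note d = smooth_on_differentiable[OF smooth_on_d_x[OF assms(2)] assms(1,3)]
    have "wirtinger \<kappa> \<alpha> f = (\<lambda>z. (1 / 2) * d_x (Inl \<alpha>) f z + (\<kappa> / 2) * d_x (Inr \<alpha>) f z)"
      by (simp add: fun_eq_iff wirtinger_def field_simps)
    then have "d_x i (wirtinger \<kappa> \<alpha> f) z =
        d_x i (\<lambda>z. (1 / 2) * d_x (Inl \<alpha>) f z + (\<kappa> / 2) * d_x (Inr \<alpha>) f z) z" by simp
    also have "\<dots> = d_x i (\<lambda>z. (1 / 2) * d_x (Inl \<alpha>) f z) z + d_x i (\<lambda>z. (\<kappa> / 2) * d_x (Inr \<alpha>) f z) z"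
      by (intro d_x_add differentiable_mult differentiable_const d)
    also have "\<dots> = (d_x i (d_x (Inl \<alpha>) f) z + \<kappa> * d_x i (d_x (Inr \<alpha>) f) z) / 2"
      unfolding d_x_bounded_linear[OF bounded_linear_mult_right d] by (simp add: field_simps)
    finally show ?thesis .
  qed
  show ?thesis
    unfolding wirtinger_def[of _ _ "wirtinger _ _ f"] *
    by (simp add: d_x_commute[OF assms, of "Inl \<alpha>"] d_x_commute[OF assms, of "Inr \<alpha>"] field_simps)
qed

lemma d_z_cnj:
  "f differentiable at z \<Longrightarrow> d_z \<alpha> (\<lambda>y. cnj (f y)) z = cnj (d_zbar \<alpha> f z)"
  by (simp add: d_z_wirtinger d_zbar_wirtinger wirtinger_cnj)

lemma d_zbar_cnj:
  "f differentiable at z \<Longrightarrow> d_zbar \<alpha> (\<lambda>y. cnj (f y)) z = cnj (d_z \<alpha> f z)"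
  by (simp add: d_z_wirtinger d_zbar_wirtinger wirtinger_cnj)

lemma z_of_x_nth: "z_of_x v $ \<alpha> = complex_of_real (v $ Inl \<alpha>) + \<i> * complex_of_real (v $ Inr \<alpha>)"
  by (simp add: z_of_x_def complex_eq_iff)

lemma z_of_x_eq_iff: "z_of_x v = z_of_x w \<longleftrightarrow> v = w"
proof
  assume "z_of_x v = z_of_x w"
  then have "v $ Inl \<alpha> = w $ Inl \<alpha>" "v $ Inr \<alpha> = w $ Inr \<alpha>" for \<alpha>
    by (simp_all add: vec_eq_iff z_of_x_def)
  then have "v $ i = w $ i" for i by (cases i) auto
  then show "v = w" by (simp add: vec_eq_iff)
qed simp

lemma z_of_x_J: "z_of_x (J v) $ \<alpha> = \<i> * z_of_x v $ \<alpha>"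
  by (simp add: z_of_x_nth J_def algebra_simps)

lemma z_of_x_axis_Inl: "z_of_x (axis (Inl \<mu>) 1) $ \<alpha> = (if \<alpha> = \<mu> then 1 else 0)"
  by (simp add: z_of_x_nth axis_def)

lemma z_of_x_axis_Inr: "z_of_x (axis (Inr \<mu>) 1) $ \<alpha> = (if \<alpha> = \<mu> then \<i> else 0)"
  by (simp add: z_of_x_nth axis_def)

text \<open>This is the splitting of the differential into its (1,0) and (0,1) parts;
  \<open>z_of_x (v z) $ \<gamma>\<close> is the value of \<open>dz\<close> with index \<gamma> on
  the real vector.\<close>

lemma deriv_along_wirtinger:
  fixes f :: "'n::finite pt \<Rightarrow> complex"
  shows "deriv_along v f z =
    (\<Sum>\<gamma>\<in>UNIV. z_of_x (v z) $ \<gamma> * d_z \<gamma> f z + cnj (z_of_x (v z) $ \<gamma>) * d_zbar \<gamma> f z)"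
  unfolding deriv_along_def sum_UNIV_Plus sum.distrib[symmetric]
proof (intro sum.cong refl)
  fix \<gamma>
  have [simp]: "\<i> * (\<i> * x) = - x" for x by (simp flip: mult.assoc)
  show "v z $ Inl \<gamma> *\<^sub>R d_x (Inl \<gamma>) f z + v z $ Inr \<gamma> *\<^sub>R d_x (Inr \<gamma>) f z =
    z_of_x (v z) $ \<gamma> * d_z \<gamma> f z + cnj (z_of_x (v z) $ \<gamma>) * d_zbar \<gamma> f z"
    by (simp add: z_of_x_nth d_z_def d_zbar_def scaleR_conv_of_real field_simps)
qed

text \<open>Applying \<open>J\<close> multiplies the (1,0) part by \<open>\<i>\<close> and the (0,1)
  part by \<open>- \<i>\<close>, so this combination isolates twice the (1,0) part.\<close>

lemma deriv_along_minus_J: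
  fixes f :: "'n::finite pt \<Rightarrow> complex"
  shows "deriv_along v f z - \<i> * deriv_along (\<lambda>y. J (v y)) f z = 2 * (\<Sum>\<gamma>\<in>UNIV. z_of_x (v z) $ \<gamma> * d_z \<gamma> f z)"
  unfolding deriv_along_wirtinger z_of_x_J sum_distrib_left sum_subtractf[symmetric]
proof (intro sum.cong refl)
  fix \<gamma>
  have [simp]: "\<i> * (\<i> * x) = - x" for x by (simp flip: mult.assoc)
  show "z_of_x (v z) $ \<gamma> * d_z \<gamma> f z + cnj (z_of_x (v z) $ \<gamma>) * d_zbar \<gamma> f z -
    \<i> * (\<i> * z_of_x (v z) $ \<gamma> * d_z \<gamma> f z + cnj (\<i> * z_of_x (v z) $ \<gamma>) * d_zbar \<gamma> f z) =
    2 * (z_of_x (v z) $ \<gamma> * d_z \<gamma> f z)"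
    by (simp add: algebra_simps)
qed

section \<open>The holomorphic tangent bundle and its coordinate frame\<close>

lemma dz_add: "dz \<alpha> (s + t) = dz \<alpha> s + dz \<alpha> t"
  by (simp add: dz_def algebra_simps)

lemma dz_smult: "dz \<alpha> (c *s s) = c * dz \<alpha> s"
  by (simp add: dz_def algebra_simps)

lemma dz_zero: "dz \<alpha> 0 = 0"
  by (simp add: dz_def)

lemma dz_sum: "dz \<alpha> (\<Sum>k\<in>I. s k) = (\<Sum>k\<in>I. dz \<alpha> (s k))"
  by (induction I rule: infinite_finite_induct) (simp_all add: dz_add dz_zero)

lemma bounded_linear_dz: "bounded_linear (dz \<alpha>)"
proof -
  have "linear (dz \<alpha>)"
    by (rule linearI) (simp_all add: dz_def algebra_simps scaleR_conv_of_real[where 'a=complex])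
  then show ?thesis by (simp add: linear_conv_bounded_linear)
qed

lemma dz_to_T10: "dz \<alpha> (to_T10 u) = z_of_x u $ \<alpha>"
  by (simp add: dz_def to_T10_def complexify_def J_def z_of_x_nth algebra_simps)

lemma T10_nth: "s \<in> T10 \<Longrightarrow> s $ Inr \<alpha> = - \<i> * s $ Inl \<alpha>"
proof -
  assume "s \<in> T10"
  then have "J s $ Inl \<alpha> = (\<i> *s s) $ Inl \<alpha>" by (simp add: T10_def)
  then have "- (s $ Inr \<alpha>) = \<i> * s $ Inl \<alpha>" by (simp add: J_def)
  then show ?thesis by (metis minus_mult_left minus_minus)
qed

text \<open>A vector of type (1,0) is determined by its values under \<open>dz\<close>, which from
  here on serve as its coordinates.\<close>

lemma T10_nth_dz:
  assumes "s \<in> T10"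
  shows "s $ Inl \<alpha> = dz \<alpha> s / 2" "s $ Inr \<alpha> = - \<i> * dz \<alpha> s / 2"
proof -
  have "dz \<alpha> s = s $ Inl \<alpha> + \<i> * (- \<i> * s $ Inl \<alpha>)" unfolding dz_def T10_nth[OF assms] ..
  also have "\<dots> = 2 * s $ Inl \<alpha>" by simp
  finally show *: "s $ Inl \<alpha> = dz \<alpha> s / 2" by simp
  show "s $ Inr \<alpha> = - \<i> * dz \<alpha> s / 2" unfolding T10_nth[OF assms] * by simp
qed

lemma T10_eqI:
  assumes "s \<in> T10" "t \<in> T10" "\<And>\<alpha>. dz \<alpha> s = dz \<alpha> t"
  shows "s = t"
proof -
  have "s $ i = t $ i" for i
    by (cases i) (simp_all add: T10_nth_dz[OF assms(1)] T10_nth_dz[OF assms(2)] assms(3))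
  then show ?thesis by (simp add: vec_eq_iff)
qed

lemma to_T10_in_T10: "to_T10 u \<in> T10"
proof -
  have "J (to_T10 u) $ i = (\<i> *s to_T10 u) $ i" for i
    by (cases i) (simp_all add: to_T10_def complexify_def J_def algebra_simps)
  then show ?thesis by (simp add: T10_def vec_eq_iff)
qed

lemma T10_add: "s \<in> T10 \<Longrightarrow> t \<in> T10 \<Longrightarrow> s + t \<in> T10"
proof -
  have "J (s + t) $ i = (J s + J t) $ i" for i by (cases i) (simp_all add: J_def)
  then have "J (s + t) = J s + J t" by (simp add: vec_eq_iff)
  moreover assume "s \<in> T10" "t \<in> T10"
  ultimately show "s + t \<in> T10" by (simp add: T10_def vec.scale_right_distrib)
qed

lemma T10_smult: "s \<in> T10 \<Longrightarrow> c *s s \<in> T10"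
proof -
  have "J (c *s s) $ i = (c *s J s) $ i" for i by (cases i) (simp_all add: J_def)
  then have "J (c *s s) = c *s J s" by (simp add: vec_eq_iff)
  moreover assume "s \<in> T10"
  ultimately show "c *s s \<in> T10" by (simp add: T10_def vec.scale_left_commute)
qed

lemma T10_zero: "0 \<in> T10"
  using T10_smult[OF to_T10_in_T10, of 0] by simp

lemma T10_sum: "(\<And>k. k \<in> I \<Longrightarrow> s k \<in> T10) \<Longrightarrow> (\<Sum>k\<in>I. s k) \<in> T10"
  by (induction I rule: infinite_finite_induct) (simp_all add: T10_zero T10_add)

text \<open>This justifies the definite description in \<open>induced\<close>. The preimage has the
  real and imaginary parts of the \<open>dz\<close> values as its components.\<close>

lemma ex_to_T10: "s \<in> T10 \<Longrightarrow> \<exists>!w. to_T10 w = s"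
proof -
  assume s: "s \<in> T10"
  define w where "w = (\<chi> i. case i of Inl \<alpha> \<Rightarrow> Re (dz \<alpha> s) | Inr \<alpha> \<Rightarrow> Im (dz \<alpha> s))"
  have w: "to_T10 w = s"
    by (rule T10_eqI[OF to_T10_in_T10 s]) (simp add: dz_to_T10 z_of_x_def w_def)
  moreover have "w' = w" if "to_T10 w' = s" for w'
  proof -
    have "dz \<alpha> (to_T10 w') = dz \<alpha> (to_T10 w)" for \<alpha> using w that by simp
    then have "z_of_x w' = z_of_x w" by (simp add: dz_to_T10 vec_eq_iff)
    then show ?thesis by (simp add: z_of_x_eq_iff)
  qed
  ultimately show ?thesis by blast
qed

text \<open>This is the coordinate field d/dz with index \<beta>, obtained as the (1,0) part of
  d/dx.\<close>

definition T10_frame :: "'n::finite \<Rightarrow> 'n cvec" where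
  "T10_frame \<beta> = to_T10 (axis (Inl \<beta>) 1)"

lemma dz_T10_frame: "dz \<alpha> (T10_frame \<beta>) = (if \<alpha> = \<beta> then 1 else 0)"
  by (simp add: T10_frame_def dz_to_T10 z_of_x_axis_Inl)

lemma T10_frame_in_T10: "T10_frame \<beta> \<in> T10"
  by (simp add: T10_frame_def to_T10_in_T10)

lemma T10_expansion:
  assumes "s \<in> T10"
  shows "s = (\<Sum>\<beta>\<in>UNIV. dz \<beta> s *s T10_frame \<beta>)"
proof (rule T10_eqI[OF assms T10_sum])
  show "dz \<alpha> s = dz \<alpha> (\<Sum>\<beta>\<in>UNIV. dz \<beta> s *s T10_frame \<beta>)" for \<alpha>
    by (simp add: dz_sum dz_smult dz_T10_frame if_distrib cong: if_cong)
qed (simp add: T10_smult T10_frame_in_T10)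

lemma herm_T10_frame:
  "herm H s (T10_frame \<mu>) = (\<Sum>\<alpha>\<in>UNIV. H $ \<alpha> $ \<mu> * dz \<alpha> s)"
  "herm H (T10_frame \<mu>) s = (\<Sum>\<beta>\<in>UNIV. H $ \<mu> $ \<beta> * cnj (dz \<beta> s))"
proof -
  show "herm H s (T10_frame \<mu>) = (\<Sum>\<alpha>\<in>UNIV. H $ \<alpha> $ \<mu> * dz \<alpha> s)"
    by (simp add: herm_def dz_T10_frame if_distrib cong: if_cong)
  show "herm H (T10_frame \<mu>) s = (\<Sum>\<beta>\<in>UNIV. H $ \<mu> $ \<beta> * cnj (dz \<beta> s))"
    unfolding herm_def by (subst sum.swap)
      (simp add: dz_T10_frame if_distrib if_distribR cong: if_cong)
qed

section \<open>The Chern connection in a chart\<close>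

lemma bounded_linear_smult_left: "bounded_linear (\<lambda>c. c *s (x :: 'n::finite cvec))"
proof -
  have "linear (\<lambda>c. c *s x)"
    by (rule linearI) (simp_all add: vec_eq_iff algebra_simps)
  then show ?thesis by (simp add: linear_conv_bounded_linear)
qed

text \<open>A Hermitian manifold seen through one chart \<open>c\<close>: \<open>V\<close> stands
  for \<open>chart_img c\<close>, and \<open>H\<close>, \<open>D\<close> for the metric and the
  Chern connection in that chart.\<close>

locale chern_chart =
  fixes V :: "'n::finite pt set" and H :: "'n pt \<Rightarrow> complex ^ 'n ^ 'n" and D :: "'n conn"
  assumes open_V: "open V"
    and smooth_H: "smooth_on V H"
    and hermitian: "z \<in> V \<Longrightarrow> H z $ \<alpha> $ \<beta> = cnj (H z $ \<beta> $ \<alpha>)"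
    and positive: "z \<in> V \<Longrightarrow> \<xi> \<noteq> 0 \<Longrightarrow>
      Re (\<Sum>\<alpha>\<in>UNIV. \<Sum>\<beta>\<in>UNIV. H z $ \<alpha> $ \<beta> * \<xi> $ \<alpha> * cnj (\<xi> $ \<beta>)) > 0"
    and chern: "chern_connection_on V H D"
begin

section \<open>Inversion of the metric matrix\<close>

abbreviation Hinv :: "'n pt \<Rightarrow> 'n \<Rightarrow> 'n \<Rightarrow> complex" where
  "Hinv z \<alpha> \<beta> \<equiv> matrix_inv (H z) $ \<alpha> $ \<beta>"

lemma matrix_inv_H:
  assumes z: "z \<in> V"
  shows "H z ** matrix_inv (H z) = mat 1" "matrix_inv (H z) ** H z = mat 1"
proof -
  have "x = 0" if x: "H z *v x = 0" for x
  proof (rule ccontr)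
    assume "x \<noteq> 0"
    \<comment> \<open>The product \<open>H z *v x\<close> contracts the second, conjugate-linear
      index, so the vector to be tested for positivity is the conjugate of \<open>x\<close>.\<close>
    define \<xi> where "\<xi> = (\<chi> \<alpha>. cnj (x $ \<alpha>))"
    have "\<xi> \<noteq> 0" using \<open>x \<noteq> 0\<close> by (auto simp: \<xi>_def vec_eq_iff)
    from positive[OF z this]
    have "0 < Re (\<Sum>\<alpha>\<in>UNIV. \<xi> $ \<alpha> * (H z *v x) $ \<alpha>)"
      by (simp add: \<xi>_def matrix_vector_mult_def sum_distrib_left ac_simps)
    then show False by (simp add: x)
  qed
  then obtain B where "B ** H z = mat 1" by (metis matrix_left_invertible_ker)
  then have "\<exists>B. H z ** B = mat 1 \<and> B ** H z = mat 1" by (metis matrix_left_right_inverse)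
  from someI_ex[OF this]
  show "H z ** matrix_inv (H z) = mat 1" "matrix_inv (H z) ** H z = mat 1"
    by (simp_all add: matrix_inv_def)
qed

lemma H_Hinv: "z \<in> V \<Longrightarrow> (\<Sum>\<mu>\<in>UNIV. H z $ \<alpha> $ \<mu> * Hinv z \<mu> \<nu>) = (if \<alpha> = \<nu> then 1 else 0)"
  using arg_cong[OF matrix_inv_H(1), of z "\<lambda>M. M $ \<alpha> $ \<nu>"]
  by (simp add: matrix_matrix_mult_def mat_def)

text \<open>The conjugate transpose of the inverse is a left inverse of the Hermitian matrix
  \<open>H z\<close>, hence equals the inverse.\<close>

lemma Hinv_hermitian:
  assumes z: "z \<in> V"
  shows "cnj (Hinv z \<alpha> \<beta>) = Hinv z \<beta> \<alpha>"
proof -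
  define B where "B = (\<chi> i j. cnj (Hinv z j i))"
  have hc: "cnj (H z $ i $ j) = H z $ j $ i" for i j
    using hermitian[OF z, of j i] by simp
  have "B ** H z = mat 1"
  proof -
    have "(\<Sum>k\<in>UNIV. cnj (Hinv z k i) * H z $ k $ j) = cnj (\<Sum>k\<in>UNIV. H z $ j $ k * Hinv z k i)" for i j
      by (simp add: hc mult.commute)
    then have "(\<Sum>k\<in>UNIV. cnj (Hinv z k i) * H z $ k $ j) = (if i = j then 1 else 0)" for i j
      by (simp add: H_Hinv[OF z])
    then show ?thesis
      by (simp add: B_def vec_eq_iff matrix_matrix_mult_def mat_def)
  qed
  then have "B = matrix_inv (H z)"
    by (metis matrix_inv_H(1)[OF z] matrix_mul_assoc matrix_mul_lid matrix_mul_rid)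
  from arg_cong[OF this, of "\<lambda>M. M $ \<beta> $ \<alpha>"] show ?thesis by (simp add: B_def)
qed

text \<open>Raises a lowered index. Identities for the connection are first obtained in lowered form
  and then solved by this lemma, so that the inverse matrix never has to be differentiated.\<close>

lemma solve_H:
  assumes z: "z \<in> V" and eq: "\<And>\<mu>. (\<Sum>\<alpha>\<in>UNIV. H z $ \<alpha> $ \<mu> * x \<alpha>) = y \<mu>"
  shows "x \<nu> = (\<Sum>\<mu>\<in>UNIV. Hinv z \<mu> \<nu> * y \<mu>)"
proof -
  have "(\<Sum>\<mu>\<in>UNIV. Hinv z \<mu> \<nu> * y \<mu>) = (\<Sum>\<mu>\<in>UNIV. \<Sum>\<alpha>\<in>UNIV. H z $ \<alpha> $ \<mu> * Hinv z \<mu> \<nu> * x \<alpha>)"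
    unfolding eq[symmetric] by (simp add: sum_distrib_left ac_simps)
  also have "\<dots> = (\<Sum>\<alpha>\<in>UNIV. (\<Sum>\<mu>\<in>UNIV. H z $ \<alpha> $ \<mu> * Hinv z \<mu> \<nu>) * x \<alpha>)"
    by (subst sum.swap) (simp add: sum_distrib_right)
  also have "\<dots> = x \<nu>"
    by (simp add: H_Hinv[OF z] if_distrib if_distribR cong: if_cong)
  finally show ?thesis by simp
qed

lemma H_cancel:
  assumes z: "z \<in> V" and eq: "\<And>\<mu>. (\<Sum>\<alpha>\<in>UNIV. H z $ \<alpha> $ \<mu> * x \<alpha>) = (\<Sum>\<alpha>\<in>UNIV. H z $ \<alpha> $ \<mu> * y \<alpha>)"
  shows "x = y"
  by (rule ext) (rule trans[OF solve_H[OF z eq] solve_H[OF z refl, symmetric]])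

lemma smooth_H_entry: "smooth_on V (\<lambda>y. H y $ \<alpha> $ \<beta>)"
  by (rule smooth_on_bounded_linear[OF bounded_linear_vec_nth open_V
      smooth_on_bounded_linear[OF bounded_linear_vec_nth open_V smooth_H]])

lemma differentiable_at: "smooth_on V f \<Longrightarrow> z \<in> V \<Longrightarrow> f differentiable at z"
  by (rule smooth_on_differentiable[OF _ open_V])

section \<open>Rules for the connection on sections over \<open>V\<close>\<close>

lemma conn: "connection_on V D"
  using chern by (simp add: chern_connection_on_def)

lemma T10_field_D: "smooth_on V v \<Longrightarrow> T10_field V s \<Longrightarrow> T10_field V (D v s)"
  using conn[unfolded connection_on_def, THEN conjunct1] by simp

lemma D_add:
  "smooth_on V v \<Longrightarrow> T10_field V s \<Longrightarrow> T10_field V t \<Longrightarrow> z \<in> V \<Longrightarrow>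
    D v (\<lambda>y. s y + t y) z = D v s z + D v t z"
  using conn[unfolded connection_on_def, THEN conjunct2, THEN conjunct2, THEN conjunct2, THEN conjunct1]
  by simp

lemma D_leibniz:
  "smooth_on V f \<Longrightarrow> smooth_on V v \<Longrightarrow> T10_field V s \<Longrightarrow> z \<in> V \<Longrightarrow>
    D v (\<lambda>y. f y *s s y) z = deriv_along v f z *s s z + f z *s D v s z"
  using conn[unfolded connection_on_def, THEN conjunct2, THEN conjunct2, THEN conjunct2, THEN conjunct2]
  by simp

lemma T10_field_const: "s \<in> T10 \<Longrightarrow> T10_field V (\<lambda>_. s)"
  by (simp add: T10_field_def smooth_on_const)

lemma T10_field_sum:
  "(\<And>k. k \<in> I \<Longrightarrow> T10_field V (s k)) \<Longrightarrow> T10_field V (\<lambda>y. \<Sum>k\<in>I. s k y)"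
  by (auto simp: T10_field_def intro: smooth_on_sum[OF open_V] T10_sum)

lemma T10_field_smult_const: "smooth_on V f \<Longrightarrow> s \<in> T10 \<Longrightarrow> T10_field V (\<lambda>y. f y *s s)"
  unfolding T10_field_def
  by (simp add: T10_smult smooth_on_bounded_linear[OF bounded_linear_smult_left open_V])

text \<open>Only the restriction of a section to \<open>V\<close> matters: apply the Leibniz rule to the indicator
  function of \<open>V\<close>.\<close>

lemma D_cong:
  assumes v: "smooth_on V v" and s: "T10_field V s" "T10_field V t"
    and eq: "\<And>y. y \<in> V \<Longrightarrow> s y = t y" and z: "z \<in> V"
  shows "D v s z = D v t z"
proof -
  define f :: "'n pt \<Rightarrow> complex" where "f y = (if y \<in> V then 1 else 0)" for y
  have f: "smooth_on V f"
    by (rule iffD1[OF smooth_on_cong[OF open_V] smooth_on_const[of V 1]]) (simp add: f_def)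
  have "(\<lambda>y. f y *s s y) = (\<lambda>y. f y *s t y)"
    by (auto simp: f_def eq fun_eq_iff)
  then have "D v (\<lambda>y. f y *s s y) z = D v (\<lambda>y. f y *s t y) z" by simp
  \<comment> \<open>The derivative terms agree because \<open>s z = t z\<close>, whatever the
    derivative of \<open>f\<close> is; at \<open>z\<close> the factor \<open>f\<close> is 1.\<close>
  then have "deriv_along v f z *s s z + f z *s D v s z = deriv_along v f z *s t z + f z *s D v t z"
    unfolding D_leibniz[OF f v s(1) z] D_leibniz[OF f v s(2) z] .
  then show ?thesis using z by (simp add: eq f_def)
qed

lemma D_sum:
  assumes v: "smooth_on V v" and z: "z \<in> V" and s: "\<And>k. T10_field V (s k)" and "finite I"
  shows "D v (\<lambda>y. \<Sum>k\<in>I. s k y) z = (\<Sum>k\<in>I. D v (s k) z)"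
  using \<open>finite I\<close>
proof (induction I)
  case empty
  \<comment> \<open>Additivity alone forces the derivative of the zero section to vanish.\<close>
  have "D v (\<lambda>y. 0 + 0) z = D v (\<lambda>y. 0) z + D v (\<lambda>y. 0) z"
    by (rule D_add[OF v T10_field_const[OF T10_zero] T10_field_const[OF T10_zero] z])
  then show ?case by simp
next
  case (insert j I)
  then show ?case by (simp add: D_add[OF v s T10_field_sum[OF s] z])
qed

text \<open>The connection 1-forms of \<open>D\<close> in the coordinate frame, evaluated on a
  constant real vector \<open>v\<close>.\<close>

definition theta :: "'n \<Rightarrow> 'n \<Rightarrow> 'n rvec \<Rightarrow> 'n pt \<Rightarrow> complex" where
  "theta \<sigma> \<beta> v z = dz \<sigma> (D (\<lambda>_. v) (\<lambda>_. T10_frame \<beta>) z)"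

lemma T10_field_frame: "T10_field V (\<lambda>_. T10_frame \<beta>)"
  by (rule T10_field_const[OF T10_frame_in_T10])

lemma smooth_on_theta: "smooth_on V (theta \<sigma> \<beta> v)"
  using T10_field_D[OF smooth_on_const T10_field_frame, of v \<beta>]
  unfolding theta_def T10_field_def by (auto intro: smooth_on_bounded_linear[OF bounded_linear_dz open_V])

text \<open>The coordinate frame has constant coefficients, so its dbar-derivative vanishes.
  Compatibility with the holomorphic structure then says that the connection forms are of type
  (1,0).\<close>

lemma theta_J:
  assumes z: "z \<in> V"
  shows "theta \<sigma> \<beta> (J v) z = \<i> * theta \<sigma> \<beta> v z"
proof -
  have "D (\<lambda>_. v) (\<lambda>_. T10_frame \<beta>) z + \<i> *s D (\<lambda>_. J v) (\<lambda>_. T10_frame \<beta>) z =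
      deriv_along (\<lambda>_. v) (\<lambda>_. T10_frame \<beta>) z + \<i> *s deriv_along (\<lambda>_. J v) (\<lambda>_. T10_frame \<beta>) z"
    using chern[unfolded chern_connection_on_def holomorphic_compatible_def,
        THEN conjunct2, THEN conjunct2, rule_format, OF conjI[OF smooth_on_const T10_field_frame] z] .
  also have "\<dots> = 0" by (simp add: deriv_along_def d_x_const)
  finally have "dz \<sigma> (D (\<lambda>_. v) (\<lambda>_. T10_frame \<beta>) z + \<i> *s D (\<lambda>_. J v) (\<lambda>_. T10_frame \<beta>) z) = 0"
    by (simp add: dz_zero)
  then have "theta \<sigma> \<beta> v z + \<i> * theta \<sigma> \<beta> (J v) z = 0"
    by (simp add: theta_def dz_add dz_smult)
  then have "\<i> * (theta \<sigma> \<beta> v z + \<i> * theta \<sigma> \<beta> (J v) z) = 0" by simp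
  then show ?thesis by (simp add: algebra_simps)
qed

text \<open>Metric compatibility, applied to two members of the coordinate frame.\<close>

lemma deriv_H:
  assumes z: "z \<in> V"
  shows "deriv_along (\<lambda>_. v) (\<lambda>y. H y $ \<beta> $ \<mu>) z =
    (\<Sum>\<alpha>\<in>UNIV. H z $ \<alpha> $ \<mu> * theta \<alpha> \<beta> v z) + (\<Sum>\<alpha>\<in>UNIV. H z $ \<beta> $ \<alpha> * cnj (theta \<alpha> \<mu> v z))"
proof -
  have "deriv_along (\<lambda>_. v) (\<lambda>y. herm (H y) (T10_frame \<beta>) (T10_frame \<mu>)) z =
      herm (H z) (D (\<lambda>_. v) (\<lambda>_. T10_frame \<beta>) z) (T10_frame \<mu>) +
      herm (H z) (T10_frame \<beta>) (D (\<lambda>_. v) (\<lambda>_. T10_frame \<mu>) z)"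
    using chern[unfolded chern_connection_on_def metric_compatible_def, THEN conjunct2, THEN conjunct1,
        rule_format, OF conjI[OF smooth_on_const conjI[OF T10_field_frame T10_field_frame]] z] .
  moreover have "herm (H y) (T10_frame \<beta>) (T10_frame \<mu>) = H y $ \<beta> $ \<mu>" for y
    by (simp add: herm_T10_frame(1) dz_T10_frame if_distrib cong: if_cong)
  ultimately show ?thesis by (simp add: herm_T10_frame theta_def)
qed

text \<open>Identifies \<open>D\<close> with the explicit Chern connection. Taking
  \<open>deriv_H\<close> at \<open>v\<close> minus \<open>\<i>\<close> times \<open>deriv_H\<close>
  at \<open>J v\<close> cancels the conjugated connection forms and doubles the others; the
  remaining equation is solved for \<open>theta\<close>.\<close>

lemma theta_eq:
  assumes z: "z \<in> V"
  shows "theta \<sigma> \<beta> v z = (\<Sum>\<gamma>\<in>UNIV. christoffel H \<sigma> \<beta> \<gamma> z * z_of_x v $ \<gamma>)"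
proof -
  have "(\<Sum>\<alpha>\<in>UNIV. H z $ \<alpha> $ \<mu> * theta \<alpha> \<beta> v z) =
      (\<Sum>\<gamma>\<in>UNIV. z_of_x v $ \<gamma> * d_z \<gamma> (\<lambda>y. H y $ \<beta> $ \<mu>) z)" for \<mu>
  proof -
    have "2 * (\<Sum>\<gamma>\<in>UNIV. z_of_x v $ \<gamma> * d_z \<gamma> (\<lambda>y. H y $ \<beta> $ \<mu>) z) =
        deriv_along (\<lambda>_. v) (\<lambda>y. H y $ \<beta> $ \<mu>) z - \<i> * deriv_along (\<lambda>_. J v) (\<lambda>y. H y $ \<beta> $ \<mu>) z"
      by (rule deriv_along_minus_J[symmetric])
    also have "\<dots> = 2 * (\<Sum>\<alpha>\<in>UNIV. H z $ \<alpha> $ \<mu> * theta \<alpha> \<beta> v z)"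
    proof -
      have 1: "(\<Sum>\<alpha>\<in>UNIV. H z $ \<alpha> $ \<mu> * theta \<alpha> \<beta> (J v) z) =
          \<i> * (\<Sum>\<alpha>\<in>UNIV. H z $ \<alpha> $ \<mu> * theta \<alpha> \<beta> v z)"
        by (simp add: theta_J[OF z] sum_distrib_left ac_simps)
      have 2: "(\<Sum>\<alpha>\<in>UNIV. H z $ \<beta> $ \<alpha> * cnj (theta \<alpha> \<mu> (J v) z)) =
          - \<i> * (\<Sum>\<alpha>\<in>UNIV. H z $ \<beta> $ \<alpha> * cnj (theta \<alpha> \<mu> v z))"
        unfolding sum_distrib_left by (simp add: theta_J[OF z] ac_simps)
      show ?thesis
        unfolding deriv_H[OF z] 1 2 by (simp add: algebra_simps)
    qed
    finally show ?thesis by simp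
  qed
  from solve_H[OF z this]
  have "theta \<sigma> \<beta> v z = (\<Sum>\<mu>\<in>UNIV. Hinv z \<mu> \<sigma> * (\<Sum>\<gamma>\<in>UNIV. z_of_x v $ \<gamma> * d_z \<gamma> (\<lambda>y. H y $ \<beta> $ \<mu>) z))" .
  also have "\<dots> = (\<Sum>\<gamma>\<in>UNIV. christoffel H \<sigma> \<beta> \<gamma> z * z_of_x v $ \<gamma>)"
    unfolding sum_distrib_left christoffel_def sum_distrib_right
    by (subst sum.swap) (simp add: ac_simps)
  finally show ?thesis .
qed

text \<open>Smoothness is inherited from \<open>D\<close>, which maps smooth sections to smooth
  sections: the coefficients are values of \<open>theta\<close> on coordinate vectors.\<close>

lemma smooth_on_christoffel: "smooth_on V (christoffel H \<sigma> \<beta> \<gamma>)"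
proof (rule iffD1[OF smooth_on_cong[OF open_V] smooth_on_theta[of \<sigma> \<beta> "axis (Inl \<gamma>) 1"]])
  show "theta \<sigma> \<beta> (axis (Inl \<gamma>) 1) z = christoffel H \<sigma> \<beta> \<gamma> z" if "z \<in> V" for z
    by (simp add: theta_eq[OF that] z_of_x_axis_Inl if_distrib cong: if_cong)
qed

text \<open>The section is expanded in the coordinate frame and the Leibniz rule applied. Since the
  expansion is valid only on \<open>V\<close>, \<open>D_cong\<close> is needed to replace the
  section.\<close>

lemma dz_D:
  assumes s: "T10_field V s" and z: "z \<in> V"
  shows "dz \<sigma> (D (\<lambda>_. v) s z) =
    deriv_along (\<lambda>_. v) (\<lambda>y. dz \<sigma> (s y)) z + (\<Sum>\<beta>\<in>UNIV. dz \<beta> (s z) * theta \<sigma> \<beta> v z)"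
proof -
  have sm: "smooth_on V (\<lambda>y. dz \<beta> (s y))" for \<beta>
    using s by (auto simp: T10_field_def intro: smooth_on_bounded_linear[OF bounded_linear_dz open_V])
  note fld = T10_field_smult_const[OF sm T10_frame_in_T10]
  have "D (\<lambda>_. v) s z = D (\<lambda>_. v) (\<lambda>y. \<Sum>\<beta>\<in>UNIV. dz \<beta> (s y) *s T10_frame \<beta>) z"
    using s by (intro D_cong[OF smooth_on_const s T10_field_sum[OF fld] _ z] T10_expansion)
      (simp add: T10_field_def)
  also have "\<dots> = (\<Sum>\<beta>\<in>UNIV. D (\<lambda>_. v) (\<lambda>y. dz \<beta> (s y) *s T10_frame \<beta>) z)"
    by (rule D_sum[OF smooth_on_const z fld finite])
  also have "\<dots> = (\<Sum>\<beta>\<in>UNIV. deriv_along (\<lambda>_. v) (\<lambda>y. dz \<beta> (s y)) z *s T10_frame \<beta> +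
      dz \<beta> (s z) *s D (\<lambda>_. v) (\<lambda>_. T10_frame \<beta>) z)"
    by (intro sum.cong refl D_leibniz[OF sm smooth_on_const T10_field_frame z])
  finally show ?thesis
    by (simp add: dz_sum dz_add dz_smult dz_T10_frame theta_def sum.distrib if_distrib cong: if_cong)
qed

section \<open>The induced connection in complex components\<close>

lemma to_T10_induced:
  assumes "smooth_on V v" "T10_field V (\<lambda>y. to_T10 (u y))" "z \<in> V"
  shows "to_T10 (induced D v u z) = D v (\<lambda>y. to_T10 (u y)) z"
proof -
  have "D v (\<lambda>y. to_T10 (u y)) z \<in> T10"
    using T10_field_D[OF assms(1,2)] assms(3) by (simp add: T10_field_def)
  from theI'[OF ex_to_T10[OF this]] show ?thesis
    by (simp add: induced_def)
qed

lemma T10_field_to_T10_induced: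
  assumes "smooth_on V v" "T10_field V (\<lambda>y. to_T10 (u y))"
  shows "T10_field V (\<lambda>y. to_T10 (induced D v u y))"
  using T10_field_D[OF assms] smooth_on_cong[OF open_V to_T10_induced[OF assms]]
  by (simp add: T10_field_def to_T10_in_T10)

lemma z_induced:
  assumes "T10_field V (\<lambda>y. to_T10 (u y))" "z \<in> V"
  shows "z_of_x (induced D (\<lambda>_. v) u z) $ \<sigma> =
    deriv_along (\<lambda>_. v) (\<lambda>y. z_of_x (u y) $ \<sigma>) z + (\<Sum>\<beta>\<in>UNIV. z_of_x (u z) $ \<beta> * theta \<sigma> \<beta> v z)"
  using dz_D[OF assms, of \<sigma> v]
  unfolding to_T10_induced[OF smooth_on_const assms, of v, symmetric] dz_to_T10 .

lemma z_induced_const: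
  assumes "z \<in> V"
  shows "z_of_x (induced D (\<lambda>_. v) (\<lambda>_. u) z) $ \<sigma> = (\<Sum>\<beta>\<in>UNIV. z_of_x u $ \<beta> * theta \<sigma> \<beta> v z)"
  by (simp add: z_induced[OF T10_field_const[OF to_T10_in_T10] assms] deriv_along_def d_x_const)

lemma deriv_along_cong:
  assumes "f differentiable at z" "z \<in> V" "\<And>y. y \<in> V \<Longrightarrow> f y = g y"
  shows "deriv_along v f z = deriv_along v g z"
  unfolding deriv_along_def by (simp only: d_x_cong[OF assms(1) open_V assms(2,3)])

lemma z_induced_induced:
  assumes z: "z \<in> V"
  shows "z_of_x (induced D (\<lambda>_. v) (induced D (\<lambda>_. w) (\<lambda>_. u)) z) $ \<sigma> =
    deriv_along (\<lambda>_. v) (\<lambda>y. \<Sum>\<beta>\<in>UNIV. z_of_x u $ \<beta> * theta \<sigma> \<beta> w y) z +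
    (\<Sum>\<alpha>\<in>UNIV. (\<Sum>\<beta>\<in>UNIV. z_of_x u $ \<beta> * theta \<alpha> \<beta> w z) * theta \<sigma> \<alpha> v z)"
proof -
  note F = T10_field_to_T10_induced[OF smooth_on_const T10_field_const[OF to_T10_in_T10], of w u]
  have "smooth_on V (\<lambda>y. dz \<sigma> (to_T10 (induced D (\<lambda>_. w) (\<lambda>_. u) y)))"
    using F by (auto simp: T10_field_def intro: smooth_on_bounded_linear[OF bounded_linear_dz open_V])
  then have "(\<lambda>y. z_of_x (induced D (\<lambda>_. w) (\<lambda>_. u) y) $ \<sigma>) differentiable at z"
    unfolding dz_to_T10 by (rule differentiable_at[OF _ z])
  from deriv_along_cong[OF this z z_induced_const]
  show ?thesis
    by (simp add: z_induced[OF F z] z_induced_const[OF z])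
qed

section \<open>Curvature and Ricci tensor\<close>

lemma Hinv_H: "z \<in> V \<Longrightarrow> (\<Sum>\<alpha>\<in>UNIV. Hinv z \<mu> \<alpha> * H z $ \<alpha> $ \<nu>) = (if \<mu> = \<nu> then 1 else 0)"
  using arg_cong[OF matrix_inv_H(2), of z "\<lambda>M. M $ \<mu> $ \<nu>"]
  by (simp add: matrix_matrix_mult_def mat_def)

text \<open>The relation \<open>H \<Gamma> = \<partial>H\<close>. Differentiating this product,
  rather than the definition of the coefficients, avoids derivatives of the inverse matrix.\<close>

lemma christoffel_lower:
  assumes z: "z \<in> V"
  shows "(\<Sum>\<alpha>\<in>UNIV. H z $ \<alpha> $ \<mu> * christoffel H \<alpha> \<beta> \<gamma> z) = d_z \<gamma> (\<lambda>y. H y $ \<beta> $ \<mu>) z"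
proof -
  have "(\<Sum>\<alpha>\<in>UNIV. H z $ \<alpha> $ \<mu> * christoffel H \<alpha> \<beta> \<gamma> z) =
      (\<Sum>\<nu>\<in>UNIV. (\<Sum>\<alpha>\<in>UNIV. Hinv z \<nu> \<alpha> * H z $ \<alpha> $ \<mu>) * d_z \<gamma> (\<lambda>y. H y $ \<beta> $ \<nu>) z)"
    unfolding christoffel_def sum_distrib_left sum_distrib_right
    by (subst sum.swap) (simp add: ac_simps)
  then show ?thesis
    by (simp add: Hinv_H[OF z] if_distrib if_distribR cong: if_cong)
qed

lemma smooth_on_d_z_H: "smooth_on V (d_z \<gamma> (\<lambda>y. H y $ \<beta> $ \<mu>))"
  unfolding d_z_wirtinger by (rule smooth_on_wirtinger[OF open_V smooth_H_entry])

lemmas differentiable_H = differentiable_at[OF smooth_H_entry]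
  and differentiable_d_z_H = differentiable_at[OF smooth_on_d_z_H]
  and differentiable_christoffel = differentiable_at[OF smooth_on_christoffel]

lemma wirtinger_christoffel_lower:
  assumes z: "z \<in> V"
  shows "(\<Sum>\<alpha>\<in>UNIV. H z $ \<alpha> $ \<mu> * wirtinger \<kappa> \<delta> (christoffel H \<alpha> \<beta> \<gamma>) z) +
    (\<Sum>\<alpha>\<in>UNIV. wirtinger \<kappa> \<delta> (\<lambda>y. H y $ \<alpha> $ \<mu>) z * christoffel H \<alpha> \<beta> \<gamma> z) =
    wirtinger \<kappa> \<delta> (d_z \<gamma> (\<lambda>y. H y $ \<beta> $ \<mu>)) z"
proof -
  have "wirtinger \<kappa> \<delta> (d_z \<gamma> (\<lambda>y. H y $ \<beta> $ \<mu>)) z =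
      wirtinger \<kappa> \<delta> (\<lambda>y. \<Sum>\<alpha>\<in>UNIV. H y $ \<alpha> $ \<mu> * christoffel H \<alpha> \<beta> \<gamma> y) z"
    by (rule wirtinger_cong[OF differentiable_d_z_H[OF z] open_V z christoffel_lower[symmetric]])
  also have "\<dots> = (\<Sum>\<alpha>\<in>UNIV. wirtinger \<kappa> \<delta> (\<lambda>y. H y $ \<alpha> $ \<mu> * christoffel H \<alpha> \<beta> \<gamma> y) z)"
    by (intro wirtinger_sum finite differentiable_mult differentiable_H differentiable_christoffel z)
  finally show ?thesis
    by (simp add: wirtinger_mult[OF differentiable_H[OF z] differentiable_christoffel[OF z]]
        sum.distrib add.commute)
qed

text \<open>Lowering the upper index turns both sides into the same second derivative of \<open>H\<close>.\<close>

lemma curvature_20_vanishes: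
  assumes z: "z \<in> V"
  shows "d_z \<gamma> (christoffel H \<sigma> \<beta> \<delta>) z +
      (\<Sum>\<alpha>\<in>UNIV. christoffel H \<sigma> \<alpha> \<gamma> z * christoffel H \<alpha> \<beta> \<delta> z) =
    d_z \<delta> (christoffel H \<sigma> \<beta> \<gamma>) z +
      (\<Sum>\<alpha>\<in>UNIV. christoffel H \<sigma> \<alpha> \<delta> z * christoffel H \<alpha> \<beta> \<gamma> z)"
proof -
  define A where "A \<gamma> \<delta> \<sigma> = d_z \<gamma> (christoffel H \<sigma> \<beta> \<delta>) z +
    (\<Sum>\<alpha>\<in>UNIV. christoffel H \<sigma> \<alpha> \<gamma> z * christoffel H \<alpha> \<beta> \<delta> z)" for \<gamma> \<delta> \<sigma>
  \<comment> \<open>The quadratic terms of \<open>A\<close>, once lowered, are the products of first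
    derivatives of \<open>H\<close> with \<open>christoffel\<close> left over by the product rule;
    together they complete the second derivative of \<open>H\<close>.\<close>
  have A: "(\<Sum>\<sigma>\<in>UNIV. H z $ \<sigma> $ \<mu> * A \<gamma> \<delta> \<sigma>) = d_z \<gamma> (d_z \<delta> (\<lambda>y. H y $ \<beta> $ \<mu>)) z" for \<gamma> \<delta> \<mu>
  proof -
    have "(\<Sum>\<sigma>\<in>UNIV. H z $ \<sigma> $ \<mu> * (\<Sum>\<alpha>\<in>UNIV. christoffel H \<sigma> \<alpha> \<gamma> z * christoffel H \<alpha> \<beta> \<delta> z)) =
        (\<Sum>\<alpha>\<in>UNIV. (\<Sum>\<sigma>\<in>UNIV. H z $ \<sigma> $ \<mu> * christoffel H \<sigma> \<alpha> \<gamma> z) * christoffel H \<alpha> \<beta> \<delta> z)"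
      unfolding sum_distrib_left sum_distrib_right
      by (subst sum.swap) (simp add: ac_simps)
    then show ?thesis
      unfolding A_def distrib_left sum.distrib christoffel_lower[OF z]
      using wirtinger_christoffel_lower[OF z, of \<mu> "- \<i>" \<gamma> \<beta> \<delta>] by (simp add: d_z_wirtinger)
  qed
  have "d_z \<gamma> (d_z \<delta> (\<lambda>y. H y $ \<beta> $ \<mu>)) z = d_z \<delta> (d_z \<gamma> (\<lambda>y. H y $ \<beta> $ \<mu>)) z" for \<mu>
    unfolding d_z_wirtinger by (rule wirtinger_commute[OF open_V smooth_H_entry z])
  then have "A \<gamma> \<delta> = A \<delta> \<gamma>"
    by (intro H_cancel[OF z]) (simp only: A)
  from fun_cong[OF this, of \<sigma>] show ?thesis by (simp only: A_def)
qed

text \<open>The differentiated relation \<open>H \<Gamma> = \<partial>H\<close>, solved for the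
  derivative of the coefficients.\<close>

lemma d_zbar_christoffel:
  assumes z: "z \<in> V"
  shows "d_zbar \<delta> (christoffel H \<sigma> \<beta> \<gamma>) z = (\<Sum>\<mu>\<in>UNIV. Hinv z \<mu> \<sigma> *
    (d_zbar \<delta> (d_z \<gamma> (\<lambda>y. H y $ \<beta> $ \<mu>)) z -
     (\<Sum>\<alpha>\<in>UNIV. d_zbar \<delta> (\<lambda>y. H y $ \<alpha> $ \<mu>) z * christoffel H \<alpha> \<beta> \<gamma> z)))"
  by (rule solve_H[OF z, of "\<lambda>\<sigma>. d_zbar \<delta> (christoffel H \<sigma> \<beta> \<gamma>) z"])
    (use wirtinger_christoffel_lower[OF z, of _ \<i> \<delta> \<beta> \<gamma>] in \<open>simp add: d_zbar_wirtinger eq_diff_eq\<close>)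

text \<open>Conjugation exchanges the two kinds of derivative, and Hermitian symmetry of
  \<open>H\<close> exchanges the matrix indices.\<close>

lemma cnj_d_z_H:
  assumes z: "z \<in> V"
  shows "cnj (d_z \<gamma> (\<lambda>y. H y $ \<beta> $ \<mu>) z) = d_zbar \<gamma> (\<lambda>y. H y $ \<mu> $ \<beta>) z"
    "cnj (d_zbar \<gamma> (\<lambda>y. H y $ \<beta> $ \<mu>) z) = d_z \<gamma> (\<lambda>y. H y $ \<mu> $ \<beta>) z"
  unfolding d_zbar_cnj[OF differentiable_H[OF z], symmetric] d_z_cnj[OF differentiable_H[OF z], symmetric]
  unfolding d_z_wirtinger d_zbar_wirtinger
  by (rule wirtinger_cong[OF differentiable_H[OF z] open_V z hermitian, symmetric]; assumption)+

lemma cnj_d_zbar_d_z_H: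
  assumes z: "z \<in> V"
  shows "cnj (d_zbar \<delta> (d_z \<gamma> (\<lambda>y. H y $ \<beta> $ \<mu>)) z) = d_zbar \<gamma> (d_z \<delta> (\<lambda>y. H y $ \<mu> $ \<beta>)) z"
proof -
  have s: "smooth_on V (d_zbar \<gamma> (\<lambda>y. H y $ \<mu> $ \<beta>))"
    unfolding d_zbar_wirtinger by (rule smooth_on_wirtinger[OF open_V smooth_H_entry])
  have "cnj (d_zbar \<delta> (d_z \<gamma> (\<lambda>y. H y $ \<beta> $ \<mu>)) z) = d_z \<delta> (\<lambda>y. cnj (d_z \<gamma> (\<lambda>y. H y $ \<beta> $ \<mu>) y)) z"
    by (rule d_z_cnj[OF differentiable_d_z_H[OF z], symmetric])
  also have "\<dots> = d_z \<delta> (d_zbar \<gamma> (\<lambda>y. H y $ \<mu> $ \<beta>)) z"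
    unfolding d_z_wirtinger[THEN fun_cong, of \<delta>]
    by (rule wirtinger_cong[OF differentiable_at[OF s z] open_V z cnj_d_z_H(1)[symmetric], symmetric])
  also have "\<dots> = d_zbar \<gamma> (d_z \<delta> (\<lambda>y. H y $ \<mu> $ \<beta>)) z"
    unfolding d_z_wirtinger d_zbar_wirtinger by (rule wirtinger_commute[OF open_V smooth_H_entry z])
  finally show ?thesis .
qed

text \<open>The index functions \<open>a\<close>, \<open>b\<close>, \<open>c\<close> let one lemma
  cover both contractions of the connection coefficients.\<close>

lemma d_zbar_sum_christoffel:
  assumes z: "z \<in> V"
  shows "d_zbar \<delta> (\<lambda>y. \<Sum>\<alpha>\<in>UNIV. christoffel H (a \<alpha>) (b \<alpha>) (c \<alpha>) y) z =
    (\<Sum>\<alpha>::'n\<in>UNIV. d_zbar \<delta> (christoffel H (a \<alpha>) (b \<alpha>) (c \<alpha>)) z)"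
  unfolding d_zbar_wirtinger
  by (rule wirtinger_sum[OF finite,
      where f = "\<lambda>\<alpha>. christoffel H (a \<alpha>) (b \<alpha>) (c \<alpha>)"])
    (rule differentiable_christoffel[OF z])

text \<open>The reason: the trace of the connection form is \<open>\<partial> log det H\<close>, with \<open>log det H\<close> real.\<close>

lemma d_zbar_trace_hermitian:
  assumes z: "z \<in> V"
  shows "cnj (d_zbar \<gamma> (\<lambda>y. \<Sum>\<alpha>\<in>UNIV. christoffel H \<alpha> \<alpha> \<delta> y) z) =
    d_zbar \<delta> (\<lambda>y. \<Sum>\<alpha>\<in>UNIV. christoffel H \<alpha> \<alpha> \<gamma> y) z"
proof -
  define B where "B \<gamma> \<delta> \<beta> \<mu> = d_zbar \<delta> (d_z \<gamma> (\<lambda>y. H y $ \<beta> $ \<mu>)) z" for \<gamma> \<delta> \<beta> \<mu>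
  define p where "p \<gamma> \<beta> \<mu> = d_z \<gamma> (\<lambda>y. H y $ \<beta> $ \<mu>) z" for \<gamma> \<beta> \<mu>
  define q where "q \<gamma> \<beta> \<mu> = d_zbar \<gamma> (\<lambda>y. H y $ \<beta> $ \<mu>) z" for \<gamma> \<beta> \<mu>
  \<comment> \<open>The two sums are the traces of \<open>H^(-1) \<partial>bar \<partial>H\<close>
    and of \<open>H^(-1) (\<partial>bar H) H^(-1) (\<partial>H)\<close>; each is shown to be
    Hermitian separately.\<close>
  have trace: "d_zbar \<delta> (\<lambda>y. \<Sum>\<alpha>\<in>UNIV. christoffel H \<alpha> \<alpha> \<gamma> y) z =
      (\<Sum>\<beta>\<in>UNIV. \<Sum>\<mu>\<in>UNIV. Hinv z \<mu> \<beta> * B \<gamma> \<delta> \<beta> \<mu>) -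
      (\<Sum>\<beta>\<in>UNIV. \<Sum>\<mu>\<in>UNIV. \<Sum>\<alpha>\<in>UNIV. \<Sum>\<nu>\<in>UNIV.
        Hinv z \<mu> \<beta> * q \<delta> \<alpha> \<mu> * Hinv z \<nu> \<alpha> * p \<gamma> \<beta> \<nu>)" for \<gamma> \<delta>
    unfolding d_zbar_sum_christoffel[OF z] d_zbar_christoffel[OF z]
    by (simp add: christoffel_def right_diff_distrib sum_subtractf sum_distrib_left mult.assoc
        B_def p_def q_def)
  have first: "cnj (\<Sum>\<beta>\<in>UNIV. \<Sum>\<mu>\<in>UNIV. Hinv z \<mu> \<beta> * B \<delta> \<gamma> \<beta> \<mu>) =
      (\<Sum>\<beta>\<in>UNIV. \<Sum>\<mu>\<in>UNIV. Hinv z \<mu> \<beta> * B \<gamma> \<delta> \<beta> \<mu>)"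
    by (subst sum.swap) (simp add: Hinv_hermitian[OF z] B_def cnj_d_zbar_d_z_H[OF z])
  have "cnj (\<Sum>\<beta>\<in>UNIV. \<Sum>\<mu>\<in>UNIV. \<Sum>\<alpha>\<in>UNIV. \<Sum>\<nu>\<in>UNIV.
        Hinv z \<mu> \<beta> * q \<gamma> \<alpha> \<mu> * Hinv z \<nu> \<alpha> * p \<delta> \<beta> \<nu>) =
      (\<Sum>\<beta>\<in>UNIV. \<Sum>\<mu>\<in>UNIV. \<Sum>\<alpha>\<in>UNIV. \<Sum>\<nu>\<in>UNIV.
        Hinv z \<beta> \<mu> * p \<gamma> \<mu> \<alpha> * Hinv z \<alpha> \<nu> * q \<delta> \<nu> \<beta>)"
    by (simp add: Hinv_hermitian[OF z] p_def q_def cnj_d_z_H[OF z])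
  \<comment> \<open>Cyclicity of the trace: exchanging the summations within both pairs of indices
    gives, up to names of bound variables, the quadratic term of \<open>trace\<close>.\<close>
  also have "\<dots> = (\<Sum>\<mu>\<in>UNIV. \<Sum>\<beta>\<in>UNIV. \<Sum>\<nu>\<in>UNIV. \<Sum>\<alpha>\<in>UNIV.
        Hinv z \<beta> \<mu> * q \<delta> \<nu> \<beta> * Hinv z \<alpha> \<nu> * p \<gamma> \<mu> \<alpha>)"
    by (rule trans[OF sum.swap], rule sum.cong[OF refl], rule sum.cong[OF refl],
        rule trans[OF sum.swap]) (simp add: ac_simps)
  finally show ?thesis
    unfolding trace complex_cnj_diff first by (simp only:)
qed

section \<open>The curvature of the induced connection in components\<close>

lemma wirtinger_theta:
  assumes z: "z \<in> V"
  shows "wirtinger \<kappa> \<gamma> (\<lambda>y. \<Sum>\<beta>\<in>UNIV. u \<beta> * theta \<sigma> \<beta> w y) z =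
    (\<Sum>\<beta>\<in>UNIV. \<Sum>\<delta>\<in>UNIV. u \<beta> * z_of_x w $ \<delta> * wirtinger \<kappa> \<gamma> (christoffel H \<sigma> \<beta> \<delta>) z)"
proof -
  have d: "(\<lambda>y. c * christoffel H \<sigma> \<beta> \<delta> y) differentiable at z" for c \<beta> \<delta>
    by (intro differentiable_mult differentiable_const differentiable_christoffel z)
  have "wirtinger \<kappa> \<gamma> (\<lambda>y. \<Sum>\<beta>\<in>UNIV. u \<beta> * theta \<sigma> \<beta> w y) z =
      wirtinger \<kappa> \<gamma> (\<lambda>y. \<Sum>\<beta>\<in>UNIV. \<Sum>\<delta>\<in>UNIV. (u \<beta> * z_of_x w $ \<delta>) * christoffel H \<sigma> \<beta> \<delta> y) z"
  proof (rule wirtinger_cong[OF _ open_V z, symmetric])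
    show "(\<lambda>y. \<Sum>\<beta>\<in>UNIV. \<Sum>\<delta>\<in>UNIV. (u \<beta> * z_of_x w $ \<delta>) * christoffel H \<sigma> \<beta> \<delta> y) differentiable at z"
      by (intro differentiable_sum finite ballI d)
    show "(\<Sum>\<beta>\<in>UNIV. \<Sum>\<delta>\<in>UNIV. (u \<beta> * z_of_x w $ \<delta>) * christoffel H \<sigma> \<beta> \<delta> y) =
        (\<Sum>\<beta>\<in>UNIV. u \<beta> * theta \<sigma> \<beta> w y)" if "y \<in> V" for y
      by (simp add: theta_eq[OF that] sum_distrib_left ac_simps)
  qed
  also have "\<dots> = (\<Sum>\<beta>\<in>UNIV. wirtinger \<kappa> \<gamma> (\<lambda>y. \<Sum>\<delta>\<in>UNIV. (u \<beta> * z_of_x w $ \<delta>) * christoffel H \<sigma> \<beta> \<delta> y) z)"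
    by (rule wirtinger_sum[OF finite]) (intro differentiable_sum finite ballI d)
  also have "\<dots> = (\<Sum>\<beta>\<in>UNIV. \<Sum>\<delta>\<in>UNIV. wirtinger \<kappa> \<gamma> (\<lambda>y. (u \<beta> * z_of_x w $ \<delta>) * christoffel H \<sigma> \<beta> \<delta> y) z)"
    by (intro sum.cong refl wirtinger_sum finite d)
  finally show ?thesis
    by (simp add: wirtinger_mult[OF differentiable_const differentiable_christoffel[OF z]] wirtinger_const)
qed

text \<open>Brings the quadratic term of the curvature into the same triple sum as the derivative
  term in \<open>deriv_along_sum_theta\<close>, so that they can be added summand by
  summand.\<close>

lemma sum_theta_theta:
  assumes z: "z \<in> V"
  shows "(\<Sum>\<alpha>\<in>UNIV. (\<Sum>\<beta>\<in>UNIV. u \<beta> * theta \<alpha> \<beta> w z) * theta \<sigma> \<alpha> v z) =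
    (\<Sum>\<beta>\<in>UNIV. \<Sum>\<gamma>\<in>UNIV. \<Sum>\<delta>\<in>UNIV. u \<beta> * (z_of_x v $ \<gamma> * z_of_x w $ \<delta> *
      (\<Sum>\<alpha>\<in>UNIV. christoffel H \<sigma> \<alpha> \<gamma> z * christoffel H \<alpha> \<beta> \<delta> z)))"
proof -
  let ?t = "\<lambda>\<alpha> \<beta> \<gamma> \<delta>. u \<beta> * (z_of_x v $ \<gamma> * z_of_x w $ \<delta> * (christoffel H \<sigma> \<alpha> \<gamma> z * christoffel H \<alpha> \<beta> \<delta> z))"
  have "(\<Sum>\<beta>\<in>UNIV. u \<beta> * theta \<alpha> \<beta> w z) * theta \<sigma> \<alpha> v z =
      (\<Sum>\<beta>\<in>UNIV. \<Sum>\<gamma>\<in>UNIV. \<Sum>\<delta>\<in>UNIV. ?t \<alpha> \<beta> \<gamma> \<delta>)" for \<alpha>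
    unfolding sum_distrib_right theta_eq[OF z] mult.assoc[of "u _"] sum_product
    unfolding sum_distrib_left
    by (rule sum.cong[OF refl], rule trans[OF sum.swap]) (simp add: ac_simps)
  then have "(\<Sum>\<alpha>\<in>UNIV. (\<Sum>\<beta>\<in>UNIV. u \<beta> * theta \<alpha> \<beta> w z) * theta \<sigma> \<alpha> v z) =
      (\<Sum>\<alpha>\<in>UNIV. \<Sum>\<beta>\<in>UNIV. \<Sum>\<gamma>\<in>UNIV. \<Sum>\<delta>\<in>UNIV. ?t \<alpha> \<beta> \<gamma> \<delta>)"
    by simp
  also have "\<dots> = (\<Sum>\<beta>\<in>UNIV. \<Sum>\<gamma>\<in>UNIV. \<Sum>\<delta>\<in>UNIV. \<Sum>\<alpha>\<in>UNIV. ?t \<alpha> \<beta> \<gamma> \<delta>)"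
    by (rule trans[OF sum.swap], rule sum.cong[OF refl], rule trans[OF sum.swap],
        rule sum.cong[OF refl], rule sum.swap)
  finally show ?thesis by (simp only: sum_distrib_left)
qed

lemma deriv_along_sum_theta:
  assumes z: "z \<in> V"
  shows "deriv_along (\<lambda>_. v) (\<lambda>y. \<Sum>\<beta>\<in>UNIV. u \<beta> * theta \<sigma> \<beta> w y) z =
    (\<Sum>\<beta>\<in>UNIV. \<Sum>\<gamma>\<in>UNIV. \<Sum>\<delta>\<in>UNIV. u \<beta> *
      (z_of_x v $ \<gamma> * z_of_x w $ \<delta> * d_z \<gamma> (christoffel H \<sigma> \<beta> \<delta>) z +
       cnj (z_of_x v $ \<gamma>) * z_of_x w $ \<delta> * d_zbar \<gamma> (christoffel H \<sigma> \<beta> \<delta>) z))"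
  unfolding deriv_along_wirtinger d_z_wirtinger d_zbar_wirtinger wirtinger_theta[OF z]
  unfolding sum_distrib_left sum.distrib[symmetric]
  by (rule trans[OF sum.swap]) (simp add: algebra_simps)

text \<open>Up to sign, the (1,1) curvature component: \<gamma> is the holomorphic and \<delta> the
  antiholomorphic form index.\<close>

abbreviation mixed_curv :: "'n \<Rightarrow> 'n \<Rightarrow> 'n \<Rightarrow> 'n \<Rightarrow> 'n pt \<Rightarrow> complex" where
  "mixed_curv \<sigma> \<beta> \<gamma> \<delta> z \<equiv> d_zbar \<delta> (christoffel H \<sigma> \<beta> \<gamma>) z"

lemma lie_bracket_const: "lie_bracket (\<lambda>_. v) (\<lambda>_. w) = (\<lambda>_. 0)"
  by (simp add: fun_eq_iff lie_bracket_def deriv_along_def d_x_const)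

lemma z_of_x_diff: "z_of_x (a - b) $ \<sigma> = z_of_x a $ \<sigma> - z_of_x b $ \<sigma>"
  by (simp add: z_of_x_nth algebra_simps)

text \<open>The (2,0) terms, collected in \<open>A\<close>, cancel by
  \<open>curvature_20_vanishes\<close>; no (0,2) terms arise because the connection forms are of
  type (1,0). The bracket of the constant fields vanishes.\<close>

lemma curvature_components:
  assumes z: "z \<in> V"
  shows "z_of_x (curvature (induced D) (\<lambda>_. u) (\<lambda>_. v) (\<lambda>_. w) z) $ \<sigma> =
    (\<Sum>\<beta>\<in>UNIV. \<Sum>\<gamma>\<in>UNIV. \<Sum>\<delta>\<in>UNIV. z_of_x u $ \<beta> *
      (cnj (z_of_x v $ \<gamma>) * z_of_x w $ \<delta> * mixed_curv \<sigma> \<beta> \<delta> \<gamma> z -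
       z_of_x v $ \<gamma> * cnj (z_of_x w $ \<delta>) * mixed_curv \<sigma> \<beta> \<gamma> \<delta> z))"
proof -
  define A where "A \<beta> \<gamma> \<delta> = d_z \<gamma> (christoffel H \<sigma> \<beta> \<delta>) z +
    (\<Sum>\<alpha>\<in>UNIV. christoffel H \<sigma> \<alpha> \<gamma> z * christoffel H \<alpha> \<beta> \<delta> z)" for \<beta> \<gamma> \<delta>
  have A: "A \<beta> \<delta> \<gamma> = A \<beta> \<gamma> \<delta>" for \<beta> \<gamma> \<delta>
    unfolding A_def by (rule curvature_20_vanishes[OF z])
  have X: "z_of_x (induced D (\<lambda>_. v) (induced D (\<lambda>_. w) (\<lambda>_. u)) z) $ \<sigma> =
      (\<Sum>\<beta>\<in>UNIV. \<Sum>\<gamma>\<in>UNIV. \<Sum>\<delta>\<in>UNIV. z_of_x u $ \<beta> *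
        (z_of_x v $ \<gamma> * z_of_x w $ \<delta> * A \<beta> \<gamma> \<delta> +
         cnj (z_of_x v $ \<gamma>) * z_of_x w $ \<delta> * mixed_curv \<sigma> \<beta> \<delta> \<gamma> z))" for v w
    unfolding z_induced_induced[OF z] sum_theta_theta[OF z] deriv_along_sum_theta[OF z] sum.distrib[symmetric]
    by (intro sum.cong refl) (simp add: A_def algebra_simps)
  \<comment> \<open>\<open>X\<close> with \<open>v\<close> and \<open>w\<close> exchanged; the
    summations over \<gamma> and \<delta> are swapped so that the \<open>A\<close> terms match those
    of \<open>X\<close>.\<close>
  have X': "z_of_x (induced D (\<lambda>_. w) (induced D (\<lambda>_. v) (\<lambda>_. u)) z) $ \<sigma> =
      (\<Sum>\<beta>\<in>UNIV. \<Sum>\<gamma>\<in>UNIV. \<Sum>\<delta>\<in>UNIV. z_of_x u $ \<beta> *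
        (z_of_x w $ \<delta> * z_of_x v $ \<gamma> * A \<beta> \<gamma> \<delta> +
         cnj (z_of_x w $ \<delta>) * z_of_x v $ \<gamma> * mixed_curv \<sigma> \<beta> \<gamma> \<delta> z))"
    unfolding X by (rule sum.cong[OF refl], rule trans[OF sum.swap]) (simp only: A)
  have "z_of_x (induced D (\<lambda>_. 0) (\<lambda>_. u) z) $ \<sigma> = 0"
    unfolding z_induced_const[OF z] theta_eq[OF z] by (simp add: z_of_x_nth)
  then show ?thesis
    unfolding curvature_def lie_bracket_const z_of_x_diff X[of v w] X' sum_subtractf[symmetric]
    by (simp add: sum_subtractf[symmetric] algebra_simps)
qed

text \<open>The components involve both \<open>v\<close> and its conjugate, so the map is only
  real-linear; this is what \<open>orthonormal_trace\<close> requires.\<close>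

lemma linear_curvature:
  assumes z: "z \<in> V"
  shows "linear (\<lambda>v. curvature (induced D) (\<lambda>_. u) (\<lambda>_. v) (\<lambda>_. w) z)" (is "linear ?M")
proof (rule linearI)
  have add: "z_of_x (a + b) $ \<sigma> = z_of_x a $ \<sigma> + z_of_x b $ \<sigma>" for a b :: "'n rvec" and \<sigma>
    by (simp add: z_of_x_nth algebra_simps)
  have scale: "z_of_x (r *\<^sub>R a) $ \<sigma> = of_real r * z_of_x a $ \<sigma>" for r and a :: "'n rvec" and \<sigma>
    by (simp add: z_of_x_nth algebra_simps)
  show "?M (a + b) = ?M a + ?M b" for a b
    unfolding z_of_x_eq_iff[symmetric] vec_eq_iff add curvature_components[OF z] sum.distrib[symmetric]
    by (simp add: algebra_simps)
  show "?M (r *\<^sub>R a) = r *\<^sub>R ?M a" for r a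
    unfolding z_of_x_eq_iff[symmetric] vec_eq_iff scale curvature_components[OF z] sum_distrib_left
    by (simp add: algebra_simps)
qed

section \<open>The Ricci tensor and its symmetry\<close>

lemma pos_def_form_riem:
  assumes z: "z \<in> V"
  shows "pos_def_form (riem (H z))"
proof (rule pos_def_form.intro)
  have riem: "riem M u v = Re (\<Sum>\<alpha>\<in>UNIV. \<Sum>\<beta>\<in>UNIV. M $ \<alpha> $ \<beta> * z_of_x u $ \<alpha> * cnj (z_of_x v $ \<beta>))" for M u v
    by (simp add: riem_def herm_def dz_to_T10)
  show "linear (\<lambda>u. riem (H z) u v)" for v
    unfolding riem
  proof (rule linearI)
    show "Re (\<Sum>\<alpha>\<in>UNIV. \<Sum>\<beta>\<in>UNIV. H z $ \<alpha> $ \<beta> * z_of_x (a + b) $ \<alpha> * cnj (z_of_x v $ \<beta>)) =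
      Re (\<Sum>\<alpha>\<in>UNIV. \<Sum>\<beta>\<in>UNIV. H z $ \<alpha> $ \<beta> * z_of_x a $ \<alpha> * cnj (z_of_x v $ \<beta>)) +
      Re (\<Sum>\<alpha>\<in>UNIV. \<Sum>\<beta>\<in>UNIV. H z $ \<alpha> $ \<beta> * z_of_x b $ \<alpha> * cnj (z_of_x v $ \<beta>))" for a b
      unfolding plus_complex.sel(1)[symmetric] sum.distrib[symmetric]
      by (intro arg_cong[where f=Re] sum.cong refl) (simp add: z_of_x_nth algebra_simps)
    have "(\<Sum>\<alpha>\<in>UNIV. \<Sum>\<beta>\<in>UNIV. H z $ \<alpha> $ \<beta> * z_of_x (r *\<^sub>R a) $ \<alpha> * cnj (z_of_x v $ \<beta>)) =
      of_real r * (\<Sum>\<alpha>\<in>UNIV. \<Sum>\<beta>\<in>UNIV. H z $ \<alpha> $ \<beta> * z_of_x a $ \<alpha> * cnj (z_of_x v $ \<beta>))" for r a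
      unfolding sum_distrib_left
      by (intro sum.cong refl) (simp add: z_of_x_nth algebra_simps)
    then show "Re (\<Sum>\<alpha>\<in>UNIV. \<Sum>\<beta>\<in>UNIV. H z $ \<alpha> $ \<beta> * z_of_x (r *\<^sub>R a) $ \<alpha> * cnj (z_of_x v $ \<beta>)) =
      r *\<^sub>R Re (\<Sum>\<alpha>\<in>UNIV. \<Sum>\<beta>\<in>UNIV. H z $ \<alpha> $ \<beta> * z_of_x a $ \<alpha> * cnj (z_of_x v $ \<beta>))" for r a
      by (simp only: times_complex.sel complex_of_real_def complex.sel mult_zero_left diff_zero real_scaleR_def)
  qed
  show "riem (H z) u v = riem (H z) v u" for u v
  proof -
    have "riem (H z) u v = Re (cnj (\<Sum>\<alpha>\<in>UNIV. \<Sum>\<beta>\<in>UNIV. H z $ \<alpha> $ \<beta> * z_of_x u $ \<alpha> * cnj (z_of_x v $ \<beta>)))"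
      by (simp only: riem cnj.sel)
    also have "\<dots> = Re (\<Sum>\<alpha>\<in>UNIV. \<Sum>\<beta>\<in>UNIV. H z $ \<beta> $ \<alpha> * z_of_x v $ \<beta> * cnj (z_of_x u $ \<alpha>))"
      by (simp add: hermitian[OF z, symmetric] ac_simps)
    also have "\<dots> = riem (H z) v u"
      unfolding riem by (subst sum.swap) (rule refl)
    finally show ?thesis .
  qed
  show "0 < riem (H z) u u" if "u \<noteq> 0" for u
  proof -
    have "z_of_x u \<noteq> z_of_x 0" using that by (simp only: z_of_x_eq_iff not_False_eq_True)
    moreover have "z_of_x (0 :: 'n rvec) = 0" by (simp add: vec_eq_iff z_of_x_nth)
    ultimately show ?thesis
      unfolding riem by (intro positive[OF z]) simp
  qed
qed

text \<open>By \<open>orthonormal_trace\<close> the frame sum is the real trace of the curvature in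
  its first form argument. A complex-antilinear map has real trace zero, while a complex-linear one
  contributes twice the real part of its complex trace.\<close>

lemma ricci_eq:
  assumes z: "z \<in> V"
  shows "ricci H D i j z = - 2 * Re (\<Sum>\<beta>\<in>UNIV. \<Sum>\<delta>\<in>UNIV.
    z_of_x (axis i 1) $ \<beta> * cnj (z_of_x (axis j 1) $ \<delta>) *
      d_zbar \<delta> (\<lambda>y. \<Sum>\<sigma>\<in>UNIV. christoffel H \<sigma> \<beta> \<sigma> y) z)" (is "_ = ?R")
proof -
  interpret pos_def_form "riem (H z)" by (rule pos_def_form_riem[OF z])
  let ?u = "z_of_x (axis i 1)" and ?w = "z_of_x (axis j 1)"
  let ?M = "\<lambda>v. curvature (induced D) (\<lambda>_. axis i 1) (\<lambda>_. v) (\<lambda>_. axis j 1) z"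
  \<comment> \<open>\<open>P\<close> and \<open>- Q\<close> are the diagonal coefficients of the
    antilinear and of the linear part of \<open>?M\<close>.\<close>
  define P where "P \<sigma> = (\<Sum>\<beta>\<in>UNIV. \<Sum>\<delta>\<in>UNIV. ?u $ \<beta> * (?w $ \<delta> * mixed_curv \<sigma> \<beta> \<delta> \<sigma> z))" for \<sigma>
  define Q where "Q \<sigma> = (\<Sum>\<beta>\<in>UNIV. \<Sum>\<delta>\<in>UNIV. ?u $ \<beta> * (cnj (?w $ \<delta>) * mixed_curv \<sigma> \<beta> \<sigma> \<delta> z))" for \<sigma>
  have comp: "z_of_x (?M v) $ \<sigma> = cnj (z_of_x v $ \<sigma>) * P \<sigma> - z_of_x v $ \<sigma> * Q \<sigma>"
    if v: "\<And>\<gamma>. \<gamma> \<noteq> \<sigma> \<Longrightarrow> z_of_x v $ \<gamma> = 0" for v \<sigma>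
  proof -
    have "(\<Sum>\<gamma>\<in>UNIV. f \<gamma>) = f \<sigma>" if "\<And>\<gamma>. \<gamma> \<noteq> \<sigma> \<Longrightarrow> f \<gamma> = 0" for f :: "'n \<Rightarrow> complex"
    proof -
      have "(\<Sum>\<gamma>\<in>UNIV. f \<gamma>) = (\<Sum>\<gamma>\<in>{\<sigma>}. f \<gamma>)"
        by (rule sum.mono_neutral_right) (auto simp: that)
      then show ?thesis by simp
    qed
    note collapse = this
    have "z_of_x (?M v) $ \<sigma> = (\<Sum>\<beta>\<in>UNIV. \<Sum>\<delta>\<in>UNIV. ?u $ \<beta> *
        (cnj (z_of_x v $ \<sigma>) * ?w $ \<delta> * mixed_curv \<sigma> \<beta> \<delta> \<sigma> z -
         z_of_x v $ \<sigma> * cnj (?w $ \<delta>) * mixed_curv \<sigma> \<beta> \<sigma> \<delta> z))"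
      unfolding curvature_components[OF z]
      by (rule sum.cong[OF refl], rule collapse) (simp add: v)
    then show ?thesis
      by (simp add: P_def Q_def sum_distrib_left sum_subtractf right_diff_distrib ac_simps)
  qed
  \<comment> \<open>Evaluated on 1 and \<open>\<i>\<close>, the antilinear part contributes opposite
    amounts, which cancel; the linear part contributes the same amount twice.\<close>
  have sum_cases: "?M (axis (Inl \<sigma>) 1) $ Inl \<sigma> + ?M (axis (Inr \<sigma>) 1) $ Inr \<sigma> = - 2 * Re (Q \<sigma>)" for \<sigma>
  proof -
    have "?M (axis (Inl \<sigma>) 1) $ Inl \<sigma> = Re (z_of_x (?M (axis (Inl \<sigma>) 1)) $ \<sigma>)"
      by (simp add: z_of_x_def)
    also have "\<dots> = Re (P \<sigma>) - Re (Q \<sigma>)"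
      by (subst comp) (simp_all add: z_of_x_axis_Inl)
    moreover have "?M (axis (Inr \<sigma>) 1) $ Inr \<sigma> = Im (z_of_x (?M (axis (Inr \<sigma>) 1)) $ \<sigma>)"
      by (simp add: z_of_x_def)
    moreover have "\<dots> = - Re (P \<sigma>) - Re (Q \<sigma>)"
      by (subst comp) (simp_all add: z_of_x_axis_Inr)
    ultimately show ?thesis by simp
  qed
  have "(\<Sum>\<sigma>\<in>UNIV. Q \<sigma>) = (\<Sum>\<beta>\<in>UNIV. \<Sum>\<delta>\<in>UNIV. \<Sum>\<sigma>\<in>UNIV. ?u $ \<beta> * (cnj (?w $ \<delta>) * mixed_curv \<sigma> \<beta> \<sigma> \<delta> z))"
    unfolding Q_def by (rule trans[OF sum.swap], rule sum.cong[OF refl], rule sum.swap)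
  then have "?R = - 2 * Re (\<Sum>\<sigma>\<in>UNIV. Q \<sigma>)"
    by (simp add: d_zbar_sum_christoffel[OF z] sum_distrib_left mult.assoc)
  moreover have "(\<Sum>i\<in>UNIV. ?M (axis i 1) $ i) = - 2 * Re (\<Sum>\<sigma>\<in>UNIV. Q \<sigma>)"
    by (simp only: sum_UNIV_Plus sum.distrib[symmetric] sum_cases Re_sum sum_distrib_left)
  ultimately have trace: "(\<Sum>i\<in>UNIV. ?M (axis i 1) $ i) = ?R" by simp
  have sum: "(\<Sum>k\<in>UNIV. riem (H z) (?M (e k)) (e k)) = ?R" if "orthonormal_frame (H z) e" for e
    using orthonormal_trace[OF _ linear_curvature[OF z], of e] that trace
    by (simp only: orthonormal_on_def orthonormal_frame_def UNIV_I simp_thms ball_UNIV)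
  \<comment> \<open>Existence of a frame gives the uniqueness half of the definite description in
    \<open>ricci\<close>.\<close>
  obtain e where e: "orthonormal_frame (H z) e"
    using ex_orthonormal_on[of UNIV] by (auto simp: orthonormal_on_def orthonormal_frame_def)
  show ?thesis
    unfolding ricci_def
  proof (rule the_equality)
    show "\<forall>e. orthonormal_frame (H z) e \<longrightarrow> ?R = (\<Sum>k\<in>UNIV. riem (H z) (?M (e k)) (e k))"
      by (intro allI impI) (rule sum[symmetric])
    show "r = ?R" if "\<forall>e. orthonormal_frame (H z) e \<longrightarrow>
        r = (\<Sum>k\<in>UNIV. riem (H z) (?M (e k)) (e k))" for r
      by (rule trans[OF that[rule_format, OF e] sum[OF e]])
  qed
qed

text \<open>The other contraction in the torsion trace has a Hermitian
  \<open>d_zbar\<close>-derivative by \<open>d_zbar_trace_hermitian\<close>, so it drops out of the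
  difference.\<close>

lemma b_form_eq:
  assumes z: "z \<in> V"
  shows "b_form H \<alpha> \<beta> z = d_zbar \<beta> (\<lambda>y. \<Sum>\<sigma>\<in>UNIV. christoffel H \<sigma> \<alpha> \<sigma> y) z -
    cnj (d_zbar \<alpha> (\<lambda>y. \<Sum>\<sigma>\<in>UNIV. christoffel H \<sigma> \<beta> \<sigma> y) z)"
proof -
  have d: "(\<lambda>y. \<Sum>\<sigma>\<in>UNIV. christoffel H (a \<sigma>) (b \<sigma>) (c \<sigma>) y) differentiable at z"
    for a b c :: "'n \<Rightarrow> 'n"
    by (intro differentiable_sum finite ballI differentiable_christoffel z)
  have T: "torsion_trace H \<beta> =
      (\<lambda>y. (\<Sum>\<sigma>\<in>UNIV. christoffel H \<sigma> \<beta> \<sigma> y) - (\<Sum>\<sigma>\<in>UNIV. christoffel H \<sigma> \<sigma> \<beta> y))" for \<beta>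
    by (simp add: fun_eq_iff torsion_trace_def torsion_def sum_subtractf)
  have "d_z \<alpha> (\<lambda>y. cnj (torsion_trace H \<beta> y)) z = cnj (d_zbar \<alpha> (torsion_trace H \<beta>) z)"
    by (rule d_z_cnj) (unfold T, intro differentiable_diff d)
  moreover have "d_zbar \<alpha> (torsion_trace H \<beta>) z =
      d_zbar \<alpha> (\<lambda>y. \<Sum>\<sigma>\<in>UNIV. christoffel H \<sigma> \<beta> \<sigma> y) z -
      d_zbar \<alpha> (\<lambda>y. \<Sum>\<sigma>\<in>UNIV. christoffel H \<sigma> \<sigma> \<beta> y) z" for \<alpha> \<beta>
    unfolding T d_zbar_wirtinger by (rule wirtinger_diff[OF d d])
  ultimately show ?thesis
    by (simp add: b_form_def d_zbar_trace_hermitian[OF z])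
qed

lemma ricci_symmetric_iff:
  assumes z: "z \<in> V"
  shows "(\<forall>i j. ricci H D i j z = ricci H D j i z) \<longleftrightarrow> (\<forall>\<alpha> \<beta>. b_form H \<alpha> \<beta> z = 0)"
proof
  let ?S = "\<lambda>\<beta> \<delta>. d_zbar \<delta> (\<lambda>y. \<Sum>\<sigma>\<in>UNIV. christoffel H \<sigma> \<beta> \<sigma> y) z"
  assume sym: "\<forall>i j. ricci H D i j z = ricci H D j i z"
  show "\<forall>\<alpha> \<beta>. b_form H \<alpha> \<beta> z = 0"
  proof (intro allI)
    fix \<alpha> \<beta>
    have pick: "(\<Sum>\<gamma>\<in>UNIV. (if \<gamma> = \<alpha> then a else 0) * f \<gamma>) = a * f \<alpha>" for a \<alpha> and f :: "'n \<Rightarrow> complex"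
      by (simp add: if_distrib[of "\<lambda>x. x * _"] cong: if_cong)
    \<comment> \<open>On a pair of coordinate vectors the double sum reduces to one entry, with
      factors \<open>a\<close> and \<open>b\<close> equal to 1 for an \<open>Inl\<close> index and
      to \<open>\<i>\<close> for an \<open>Inr\<close> index.\<close>
    have delta: "(\<Sum>\<gamma>\<in>UNIV. \<Sum>\<delta>\<in>UNIV. (if \<gamma> = \<alpha> then a else 0) * cnj (if \<delta> = \<beta> then b else 0) * ?S \<gamma> \<delta>) =
        a * cnj b * ?S \<alpha> \<beta>" for a b \<alpha> \<beta>
      by (simp only: mult.assoc sum_distrib_left[symmetric] if_distrib[of cnj] complex_cnj_zero pick)
    have "Re (?S \<alpha> \<beta>) = Re (?S \<beta> \<alpha>)"
      using sym[rule_format, of "Inl \<alpha>" "Inl \<beta>"]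
      unfolding ricci_eq[OF z] z_of_x_axis_Inl delta by simp
    \<comment> \<open>Replacing one coordinate vector by its image under \<open>J\<close> brings in
      the factors \<open>- \<i>\<close> and \<open>\<i>\<close> on the two sides, which turn real
      parts into imaginary parts of opposite sign.\<close>
    moreover have "Im (?S \<alpha> \<beta>) = - Im (?S \<beta> \<alpha>)"
      using sym[rule_format, of "Inl \<alpha>" "Inr \<beta>"]
      unfolding ricci_eq[OF z] z_of_x_axis_Inl z_of_x_axis_Inr delta by simp
    ultimately show "b_form H \<alpha> \<beta> z = 0"
      by (simp add: b_form_eq[OF z] complex_eq_iff)
  qed
next
  let ?S = "\<lambda>\<beta> \<delta>. d_zbar \<delta> (\<lambda>y. \<Sum>\<sigma>\<in>UNIV. christoffel H \<sigma> \<beta> \<sigma> y) z"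
  assume b: "\<forall>\<alpha> \<beta>. b_form H \<alpha> \<beta> z = 0"
  have S: "cnj (?S \<beta> \<alpha>) = ?S \<alpha> \<beta>" for \<alpha> \<beta>
    using b[rule_format, of \<alpha> \<beta>] unfolding b_form_eq[OF z] right_minus_eq by (rule sym)
  show "\<forall>i j. ricci H D i j z = ricci H D j i z"
  proof (intro allI)
    fix i j :: "'n + 'n"
    let ?u = "z_of_x (axis i 1)" and ?w = "z_of_x (axis j 1)"
    have "cnj (\<Sum>\<beta>\<in>UNIV. \<Sum>\<delta>\<in>UNIV. ?u $ \<beta> * cnj (?w $ \<delta>) * ?S \<beta> \<delta>) =
        (\<Sum>\<beta>\<in>UNIV. \<Sum>\<delta>\<in>UNIV. ?w $ \<delta> * cnj (?u $ \<beta>) * ?S \<delta> \<beta>)"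
      by (simp add: S mult.commute)
    also have "\<dots> = (\<Sum>\<delta>\<in>UNIV. \<Sum>\<beta>\<in>UNIV. ?w $ \<delta> * cnj (?u $ \<beta>) * ?S \<delta> \<beta>)"
      by (rule sum.swap)
    finally have "cnj (\<Sum>\<beta>\<in>UNIV. \<Sum>\<delta>\<in>UNIV. ?u $ \<beta> * cnj (?w $ \<delta>) * ?S \<beta> \<delta>) =
        (\<Sum>\<beta>\<in>UNIV. \<Sum>\<delta>\<in>UNIV. ?w $ \<beta> * cnj (?u $ \<delta>) * ?S \<beta> \<delta>)" .
    from arg_cong[OF this, of Re] show "ricci H D i j z = ricci H D j i z"
      by (simp only: ricci_eq[OF z] cnj.sel)
  qed
qed

end

section \<open>From single charts to the manifold\<close>

theorem mainTheorem5:
  fixes A :: "('a::{t2_space, second_countable_topology}, 'n::finite) chart set"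
    and h :: "('a, 'n) chart \<Rightarrow> 'n pt \<Rightarrow> complex ^ 'n ^ 'n"
    and D :: "('a, 'n) chart \<Rightarrow> 'n conn"
  assumes "hermitian_manifold A h"
    and "\<And>c. c \<in> A \<Longrightarrow> chern_connection_on (chart_img c) (h c) (D c)"
  shows "(\<forall>c\<in>A. \<forall>z\<in>chart_img c. \<forall>i j. ricci (h c) (D c) i j z = ricci (h c) (D c) j i z) \<longleftrightarrow>
         (\<forall>c\<in>A. \<forall>z\<in>chart_img c. \<forall>\<alpha> \<beta>. b_form (h c) \<alpha> \<beta> z = 0)"
proof -
  have "chern_chart (chart_img c) (h c) (D c)" if c: "c \<in> A" for c
  proof
    have atlas: "complex_atlas A" and metric: "hermitian_metric A h"
      using assms(1) by (simp_all add: hermitian_manifold_def)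
    show "open (chart_img c)"
      using atlas c by (simp add: complex_atlas_def is_chart_def)
    show "smooth_on (chart_img c) (h c)"
      using metric[unfolded hermitian_metric_def, THEN conjunct1] c by blast
    show "h c z $ \<alpha> $ \<beta> = cnj (h c z $ \<beta> $ \<alpha>)" if "z \<in> chart_img c" for z \<alpha> \<beta>
      using metric[unfolded hermitian_metric_def, THEN conjunct2, THEN conjunct1] c that by blast
    show "Re (\<Sum>\<alpha>\<in>UNIV. \<Sum>\<beta>\<in>UNIV. h c z $ \<alpha> $ \<beta> * \<xi> $ \<alpha> * cnj (\<xi> $ \<beta>)) > 0"
      if "z \<in> chart_img c" "\<xi> \<noteq> 0" for z \<xi>
      using metric[unfolded hermitian_metric_def, THEN conjunct2, THEN conjunct2, THEN conjunct1] c that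
      by blast
    show "chern_connection_on (chart_img c) (h c) (D c)" by (rule assms(2)[OF c])
  qed
  \<comment> \<open>The equivalence already holds at every point of every chart, so both sides may
    be quantified over charts and points.\<close>
  from chern_chart.ricci_symmetric_iff[OF this] show ?thesis by blast
qed

end
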